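(* Let $M_0,M_1:[0,\infty)\to\mathsf{Vec}$ be constructible persistence modules with persistence diagrams $m_0:=\partial\,\mathsf{null}_{M_0}$ and $m_1:=\partial\,\mathsf{null}_{M_1}$, respectively. Then $$d_B(m_0,m_1)\le d_I(M_0,M_1).$$
   Context: Fix a field $\mathbb{K}$; $\mathsf{Vec}$ is the category of finite-dimensional $\mathbb{K}$-vector spaces. A persistence module is a functor $M:P\to\mathsf{Vec}$ from a poset $P$. Infima over empty sets are $\infty$. Constructibility. A co-closure operator on a poset $P$ is an order-preserving map $c:P\to P$ with $c(p)\le p$ for all $p$ and $c\circ c=c$. $M:P\to\mathsf{Vec}$ is constructible if there is a co-closure operator $c$ on $P$ with finite image such that $M\circ c\cong M$. Diagrams. For a poset $P$, $\bar P=\{(a,b)\in P\times P:a\le b\}$ with the product order, $\bar P^\circ=\bar P\setminus\{(a,a):a\in P\}$; an order-preserving $f:P\to Q$ induces $\bar f(a,b)=(f(a),f(b))$. A persistence diagram is a finitely supported function $\bar P\to\mathbb{Z}$. The nullity function of $M:P\to\mathsf{Vec}$ is $\mathsf{null}_M:\bar P\to\mathbb{Z}$, $\mathsf{null}_M(a,b)=\dim\ker M(a\le b)$. For a function $m:X\to\mathbb{Z}$ on a poset, its Möbius inversion is the (unique, if it exists) $\partial m:X\to\mathbb{Z}$ with $m(y)=\sum_{x\le y}\partial m(x)$ for all $y$, each sum having finitely many nonzero terms. If $M$ is constructible, $\partial\,\mathsf{null}_M$ exists (on the poset $\bar P$) and is finitely supported. Bottleneck distance. On $P=[0,\infty)$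 use $d_P(x,y)=|x-y|$ and on $\bar P$ use $d_{\bar P}((i_0,i_1),(j_0,j_1))=\max\{|i_0-j_0|,|i_1-j_1|\}$. A matching between persistence diagrams $w_0,w_1:\bar P\to\mathbb{Z}$ consists of a poset $R$, a finitely supported nonnegative function $\nu:\bar R\to\mathbb{Z}$, and order-preserving maps $f_0,f_1:R\to P$ such that for all $I\in\bar P^\circ$ and $i\in\{0,1\}$, $w_i(I)=\sum_{J\in\bar f_i^{-1}(I)}\nu(J)$. Its cost is $\|\nu\|=\max_{J\in\mathrm{supp}(\nu)}d_{\bar P}(\bar f_0(J),\bar f_1(J))$ if $\nu\neq0$, and $\|\nu\|=0$ if $\nu\equiv0$. The bottleneck distance $d_B(w_0,w_1)$ is the infimum of $\|\nu\|$ over all matchings. Interleaving distance. For $\varepsilon>0$, let $[0,\infty)\times_\varepsilon\{0,1\}$ be the poset with underlying set $[0,\infty)\times\{0,1\}$ and $(a,t)\le(b,s)$ iff $a+\varepsilon|t-s|\le b$; let $\iota_i(a)=(a,i)$. An $\varepsilon$-interleaving between $M_0,M_1:[0,\infty)\to\mathsf{Vec}$ is a functor $\Gamma:[0,\infty)\times_\varepsilon\{0,1\}\to\mathsf{Vec}$ with $\Gamma\circ\iota_0\cong M_0$ and $\Gamma\circ\iota_1\cong M_1$. $d_I(M_0,M_1)$ is the infimum of all $\varepsilon>0$ for which an $\varepsilon$-interleaving exists. *)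

theory Defs
  imports "Jordan_Normal_Form.Missing_VectorSpace" "HOL-Library.Extended_Real"
begin

text \<open>
  A poset is a relation \<open>P\<close> with \<open>Partial_order P\<close>. Its elements are \<open>Field P\<close>, and \<open>(a, b) \<in> P\<close>
  means \<open>a \<le> b\<close>. As a set, \<open>P\<close> is thus exactly the set of comparable pairs of the poset.
\<close>

definition order_preserving :: "'p rel \<Rightarrow> 'q rel \<Rightarrow> ('p \<Rightarrow> 'q) \<Rightarrow> bool" where
  "order_preserving P Q f \<longleftrightarrow> (\<forall>a b. (a, b) \<in> P \<longrightarrow> (f a, f b) \<in> Q)"

definition bar_order :: "'p rel \<Rightarrow> ('p \<times> 'p) rel" where
  "bar_order P = {(I, J). I \<in> P \<and> J \<in> P \<and> (fst I, fst J) \<in> P \<and> (snd I, snd J) \<in> P}"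

definition half_line :: "real rel" where
  "half_line = {(a, b). 0 \<le> a \<and> a \<le> b}"

definition interleaving_poset :: "real \<Rightarrow> (real \<times> nat) rel" where
  "interleaving_poset \<epsilon> =
     {((a, t), (b, s)). 0 \<le> a \<and> 0 \<le> b \<and> t \<in> {0, 1} \<and> s \<in> {0, 1} \<and>
        a + \<epsilon> * \<bar>real t - real s\<bar> \<le> b}"

lemma Partial_orderI:
  assumes "\<And>a b. (a, b) \<in> P \<Longrightarrow> (a, a) \<in> P \<and> (b, b) \<in> P"
    and "\<And>a b c. (a, b) \<in> P \<Longrightarrow> (b, c) \<in> P \<Longrightarrow> (a, c) \<in> P"
    and "\<And>a b. (a, b) \<in> P \<Longrightarrow> (b, a) \<in> P \<Longrightarrow> a = b"
  shows "Partial_order P"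
proof -
  have "refl_on (Field P) P" unfolding refl_on_def Field_def using assms(1) by blast
  moreover have "trans P" using assms(2) by (meson transI)
  moreover have "antisym P" using assms(3) by (meson antisymI)
  moreover have "P \<subseteq> Field P \<times> Field P" by (auto simp: Field_def)
  ultimately show ?thesis by (simp add: partial_order_on_def preorder_on_def)
qed

lemma Partial_orderD:
  assumes "Partial_order P"
  shows "a \<in> Field P \<Longrightarrow> (a, a) \<in> P"
    and "(a, b) \<in> P \<Longrightarrow> (b, c) \<in> P \<Longrightarrow> (a, c) \<in> P"
    and "(a, b) \<in> P \<Longrightarrow> (b, a) \<in> P \<Longrightarrow> a = b"
  using assms
  by (auto simp: partial_order_on_def preorder_on_def refl_on_def dest: transD antisymD)

lemma Partial_order_half_line: "Partial_order half_line"
  by (rule Partial_orderI) (auto simp: half_line_def)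

lemma Field_half_line: "Field half_line = {0..}"
  by (force simp: half_line_def Field_def)

lemma Partial_order_interleaving_poset:
  assumes "0 < \<epsilon>"
  shows "Partial_order (interleaving_poset \<epsilon>)"
  by (rule Partial_orderI) (use assms in \<open>auto simp: interleaving_poset_def split: if_splits\<close>)

lemma Field_interleaving_poset:
  "Field (interleaving_poset \<epsilon>) = {0..} \<times> {0, 1}"
  by (force simp: interleaving_poset_def Field_def)

lemma Partial_order_bar_order:
  assumes "Partial_order P"
  shows "Partial_order (bar_order P)"
proof (rule Partial_orderI)
  have "(a, a) \<in> P" "(b, b) \<in> P" if "(a, b) \<in> P" for a b
    using that Partial_orderD(1)[OF assms] by (auto simp: Field_def)
  then show "(I, I) \<in> bar_order P \<and> (J, J) \<in> bar_order P" if "(I, J) \<in> bar_order P" for I J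
    using that by (auto simp: bar_order_def)
  show "(I, K) \<in> bar_order P" if "(I, J) \<in> bar_order P" "(J, K) \<in> bar_order P" for I J K
    using that by (auto simp: bar_order_def dest: Partial_orderD(2)[OF assms])
  show "I = J" if "(I, J) \<in> bar_order P" "(J, I) \<in> bar_order P" for I J
    using that by (auto simp: bar_order_def intro!: prod_eqI dest: Partial_orderD(3)[OF assms])
qed

lemma Field_bar_order:
  assumes "Partial_order P"
  shows "Field (bar_order P) = P"
proof
  show "Field (bar_order P) \<subseteq> P" by (auto simp: Field_def bar_order_def)
  show "P \<subseteq> Field (bar_order P)"
  proof
    fix I assume "I \<in> P"
    then have "(I, I) \<in> bar_order P"
      using Partial_orderD(1)[OF assms] by (cases I) (auto simp: bar_order_def Field_def)
    then show "I \<in> Field (bar_order P)" by (auto simp: Field_def)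
  qed
qed

text \<open>
  The data of a functor from a poset to vector spaces. Only the values of \<open>pm_space\<close> on elements,
  those of \<open>pm_map\<close> on comparable pairs, and those of each structure map on the carrier of its
  source are meaningful.
\<close>

record ('p, 'k, 'v) pmod =
  pm_space :: "'p \<Rightarrow> ('k, 'v) module"
  pm_map :: "'p \<Rightarrow> 'p \<Rightarrow> 'v \<Rightarrow> 'v"

definition persistence_module ::
    "('k, 'r) ring_scheme \<Rightarrow> 'p rel \<Rightarrow> ('p, 'k, 'v) pmod \<Rightarrow> bool" where
  "persistence_module K P M \<longleftrightarrow>
     (\<forall>a \<in> Field P. vectorspace K (pm_space M a) \<and> vectorspace.fin_dim K (pm_space M a)) \<and>
     (\<forall>a b. (a, b) \<in> P \<longrightarrow> linear_map K (pm_space M a) (pm_space M b) (pm_map M a b)) \<and>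
     (\<forall>a \<in> Field P. \<forall>x \<in> carrier (pm_space M a). pm_map M a a x = x) \<and>
     (\<forall>a b c. (a, b) \<in> P \<longrightarrow> (b, c) \<in> P \<longrightarrow>
        (\<forall>x \<in> carrier (pm_space M a). pm_map M b c (pm_map M a b x) = pm_map M a c x))"

definition pm_iso ::
    "('k, 'r) ring_scheme \<Rightarrow> 'p rel \<Rightarrow> ('p, 'k, 'v) pmod \<Rightarrow> ('p, 'k, 'w) pmod \<Rightarrow> bool" where
  "pm_iso K P M N \<longleftrightarrow> (\<exists>\<phi>.
     (\<forall>a \<in> Field P. linear_map K (pm_space M a) (pm_space N a) (\<phi> a) \<and>
        bij_betw (\<phi> a) (carrier (pm_space M a)) (carrier (pm_space N a))) \<and>
     (\<forall>a b. (a, b) \<in> P \<longrightarrow>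
        (\<forall>x \<in> carrier (pm_space M a). \<phi> b (pm_map M a b x) = pm_map N a b (\<phi> a x))))"

definition pm_comp :: "('q, 'k, 'v) pmod \<Rightarrow> ('p \<Rightarrow> 'q) \<Rightarrow> ('p, 'k, 'v) pmod" where
  "pm_comp M f = \<lparr>pm_space = (\<lambda>a. pm_space M (f a)), pm_map = (\<lambda>a b. pm_map M (f a) (f b))\<rparr>"

definition co_closure_operator :: "'p rel \<Rightarrow> ('p \<Rightarrow> 'p) \<Rightarrow> bool" where
  "co_closure_operator P c \<longleftrightarrow>
     order_preserving P P c \<and> (\<forall>p \<in> Field P. (c p, p) \<in> P \<and> c (c p) = c p)"

definition constructible :: "('k, 'r) ring_scheme \<Rightarrow> 'p rel \<Rightarrow> ('p, 'k, 'v) pmod \<Rightarrow> bool" where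
  "constructible K P M \<longleftrightarrow>
     (\<exists>c. co_closure_operator P c \<and> finite (c ` Field P) \<and> pm_iso K P (pm_comp M c) M)"

definition nullity ::
    "('k, 'r) ring_scheme \<Rightarrow> ('p, 'k, 'v) pmod \<Rightarrow> 'p \<times> 'p \<Rightarrow> int" where
  "nullity K M = (\<lambda>(a, b). int (vectorspace.dim K
     ((pm_space M a)\<lparr>carrier := mod_hom.ker (pm_space M a) (pm_space M b) (pm_map M a b)\<rparr>)))"

text \<open>
  The finiteness condition makes the sum meaningful (\<open>sum\<close> over an infinite set is 0). A function
  on the poset \<open>X\<close> is represented by a total function; the inversion is normalised to vanish off
  \<open>Field X\<close> so that it is unique as a HOL function, see \<open>moebius_inversion_unique\<close>.
\<close>

definition is_moebius_inversion :: "'x rel \<Rightarrow> ('x \<Rightarrow> int) \<Rightarrow> ('x \<Rightarrow> int) \<Rightarrow> bool" where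
  "is_moebius_inversion X m dm \<longleftrightarrow>
     (\<forall>y \<in> Field X. finite {x. (x, y) \<in> X \<and> dm x \<noteq> 0} \<and>
        m y = (\<Sum>x | (x, y) \<in> X \<and> dm x \<noteq> 0. dm x)) \<and>
     (\<forall>x. x \<notin> Field X \<longrightarrow> dm x = 0)"

definition moebius_inversion :: "'x rel \<Rightarrow> ('x \<Rightarrow> int) \<Rightarrow> 'x \<Rightarrow> int" where
  "moebius_inversion X m = (THE dm. is_moebius_inversion X m dm)"

lemma moebius_inversion_unique:
  assumes X: "Partial_order X"
    and d: "is_moebius_inversion X m d" and e: "is_moebius_inversion X m e"
  shows "d = e"
proof (rule ccontr)
  assume "d \<noteq> e"
  then obtain y where y: "d y \<noteq> e y" by auto
  then have "y \<in> Field X" using d e unfolding is_moebius_inversion_def by metis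
  define S where "S z = {x. (x, z) \<in> X \<and> d x \<noteq> 0} \<union> {x. (x, z) \<in> X \<and> e x \<noteq> 0}" for z
  have finS: "finite (S z)" if "z \<in> Field X" for z
    using that d e unfolding is_moebius_inversion_def S_def by auto
  have eq: "(\<Sum>x \<in> S z. d x - e x) = 0" if z: "z \<in> Field X" for z
  proof -
    have "(\<Sum>x | (x, z) \<in> X \<and> d x \<noteq> 0. d x) = sum d (S z)"
      using finS[OF z] by (intro sum.mono_neutral_left) (auto simp: S_def)
    moreover have "(\<Sum>x | (x, z) \<in> X \<and> e x \<noteq> 0. e x) = sum e (S z)"
      using finS[OF z] by (intro sum.mono_neutral_left) (auto simp: S_def)
    ultimately show ?thesis
      using d e z unfolding is_moebius_inversion_def by (simp add: sum_subtractf)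
  qed
  define D where "D = {x \<in> S y. d x \<noteq> e x}"
  have "finite D" using finS[OF \<open>y \<in> Field X\<close>] by (simp add: D_def)
  have "y \<in> D" using y Partial_orderD(1)[OF X \<open>y \<in> Field X\<close>] by (auto simp: D_def S_def)
  have "\<exists>x0 \<in> D. \<forall>x \<in> D. (x, x0) \<in> X \<longrightarrow> x = x0"
  proof -
    have "asymp_on D (\<lambda>a b. (a, b) \<in> X \<and> a \<noteq> b)"
      by (auto intro!: asymp_onI dest: Partial_orderD(3)[OF X])
    moreover have "transp_on D (\<lambda>a b. (a, b) \<in> X \<and> a \<noteq> b)"
      by (rule transp_onI) (meson Partial_orderD(2,3)[OF X])
    ultimately show ?thesis
      using Finite_Set.bex_min_element[OF \<open>finite D\<close>] \<open>y \<in> D\<close> by blast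
  qed
  then obtain x0 where x0: "x0 \<in> D" and min: "\<And>x. x \<in> D \<Longrightarrow> (x, x0) \<in> X \<Longrightarrow> x = x0" by blast
  have x0y: "(x0, y) \<in> X" and x0F: "x0 \<in> Field X"
    using x0 by (auto simp: D_def S_def Field_def)
  have "d x = e x" if "x \<in> S x0 - {x0}" for x
  proof (rule ccontr)
    assume "d x \<noteq> e x"
    moreover have "(x, x0) \<in> X" using that by (auto simp: S_def)
    ultimately have "x \<in> D" using Partial_orderD(2)[OF X _ x0y] by (auto simp: D_def S_def)
    then show False using min \<open>(x, x0) \<in> X\<close> that by blast
  qed
  moreover have "x0 \<in> S x0"
    using x0 Partial_orderD(1)[OF X x0F] by (auto simp: D_def S_def)
  ultimately have "(\<Sum>x \<in> S x0. d x - e x) = d x0 - e x0"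
    using finS[OF x0F] by (simp add: sum.remove)
  then show False using eq[OF x0F] x0 by (simp add: D_def)
qed

definition persistence_diagram ::
    "('k, 'r) ring_scheme \<Rightarrow> 'p rel \<Rightarrow> ('p, 'k, 'v) pmod \<Rightarrow> 'p \<times> 'p \<Rightarrow> int" where
  "persistence_diagram K P M = moebius_inversion (bar_order P) (nullity K M)"

text \<open>
  The condition on \<open>w0\<close> and \<open>w1\<close> is imposed off the diagonal only. The sums over the fibres of
  \<open>map_prod f f\<close> are restricted to the (finite) support of \<open>\<nu>\<close> since the fibres may be infinite.
\<close>

definition is_matching ::
    "'p rel \<Rightarrow> ('p \<times> 'p \<Rightarrow> int) \<Rightarrow> ('p \<times> 'p \<Rightarrow> int) \<Rightarrow>
     'r rel \<Rightarrow> ('r \<times> 'r \<Rightarrow> int) \<Rightarrow> ('r \<Rightarrow> 'p) \<Rightarrow> ('r \<Rightarrow> 'p) \<Rightarrow> bool" where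
  "is_matching P w0 w1 R \<nu> f0 f1 \<longleftrightarrow>
     Partial_order R \<and> finite {J \<in> R. \<nu> J \<noteq> 0} \<and> (\<forall>J \<in> R. 0 \<le> \<nu> J) \<and>
     order_preserving R P f0 \<and> order_preserving R P f1 \<and>
     (\<forall>I \<in> P. fst I \<noteq> snd I \<longrightarrow>
        w0 I = (\<Sum>J | J \<in> R \<and> \<nu> J \<noteq> 0 \<and> map_prod f0 f0 J = I. \<nu> J) \<and>
        w1 I = (\<Sum>J | J \<in> R \<and> \<nu> J \<noteq> 0 \<and> map_prod f1 f1 J = I. \<nu> J))"

definition dist_bar :: "real \<times> real \<Rightarrow> real \<times> real \<Rightarrow> real" where
  "dist_bar I J = max \<bar>fst I - fst J\<bar> \<bar>snd I - snd J\<bar>"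

definition matching_cost ::
    "'r rel \<Rightarrow> ('r \<times> 'r \<Rightarrow> int) \<Rightarrow> ('r \<Rightarrow> real) \<Rightarrow> ('r \<Rightarrow> real) \<Rightarrow> real" where
  "matching_cost R \<nu> f0 f1 =
     (if {J \<in> R. \<nu> J \<noteq> 0} = {} then 0
      else Max ((\<lambda>J. dist_bar (map_prod f0 f0 J) (map_prod f1 f1 J)) ` {J \<in> R. \<nu> J \<noteq> 0}))"

text \<open>
  HOL cannot quantify over the type of elements of \<open>R\<close>. Posets on \<open>nat\<close> suffice, because only
  the finitely many endpoints of pairs in the support of \<open>\<nu>\<close> matter: see \<open>matching_on_nat\<close>.
\<close>

definition bottleneck_distance :: "(real \<times> real \<Rightarrow> int) \<Rightarrow> (real \<times> real \<Rightarrow> int) \<Rightarrow> ereal" where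
  "bottleneck_distance w0 w1 =
     Inf {ereal (matching_cost R \<nu> f0 f1) | (R :: nat rel) \<nu> f0 f1.
            is_matching half_line w0 w1 R \<nu> f0 f1}"

lemma matching_on_nat:
  fixes R :: "'r rel" and P :: "'p rel"
  assumes "is_matching P w0 w1 R \<nu> f0 f1"
  obtains R' :: "nat rel" and \<nu>' g0 g1
  where "is_matching P w0 w1 R' \<nu>' g0 g1"
    and "(\<lambda>J. (map_prod g0 g0 J, map_prod g1 g1 J)) ` {J \<in> R'. \<nu>' J \<noteq> 0} =
         (\<lambda>J. (map_prod f0 f0 J, map_prod f1 f1 J)) ` {J \<in> R. \<nu> J \<noteq> 0}"
proof -
  note D = assms[unfolded is_matching_def]
  note R = D[THEN conjunct1] and fin = D[THEN conjunct2, THEN conjunct1]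
    and nonneg = D[THEN conjunct2, THEN conjunct2, THEN conjunct1]
    and f = D[THEN conjunct2, THEN conjunct2, THEN conjunct2, THEN conjunct1]
      D[THEN conjunct2, THEN conjunct2, THEN conjunct2, THEN conjunct2, THEN conjunct1]
    and w = D[THEN conjunct2, THEN conjunct2, THEN conjunct2, THEN conjunct2, THEN conjunct2]
  define S where "S = {J \<in> R. \<nu> J \<noteq> 0}"
  define E where "E = fst ` S \<union> snd ` S"
  have "finite E" using fin by (simp add: E_def S_def)
  then obtain h :: "'r \<Rightarrow> nat" where h: "inj_on h E"
    using finite_imp_inj_to_nat_seg[OF \<open>finite E\<close>] by (elim exE conjE)
  define k where "k = inv_into E h"
  have kh[simp]: "k (h x) = x" if "x \<in> E" for x using that h by (simp add: k_def)
  define R' where "R' = {(h a, h b) | a b. a \<in> E \<and> b \<in> E \<and> (a, b) \<in> R}"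
  define \<nu>' where "\<nu>' = (\<lambda>J. \<nu> (map_prod k k J))"
  have EF: "(a, a) \<in> R" if "a \<in> E" for a
    using that by (intro Partial_orderD(1)[OF R]) (auto simp: E_def S_def intro: FieldI1 FieldI2)
  have SE: "S \<subseteq> E \<times> E" by (force simp: E_def)
  have supp: "{J \<in> R'. \<nu>' J \<noteq> 0} = map_prod h h ` S"
  proof
    show "{J \<in> R'. \<nu>' J \<noteq> 0} \<subseteq> map_prod h h ` S"
    proof
      fix J assume "J \<in> {J \<in> R'. \<nu>' J \<noteq> 0}"
      then obtain a b where "J = map_prod h h (a, b)" "(a, b) \<in> S"
        by (auto simp: R'_def \<nu>'_def S_def)
      then show "J \<in> map_prod h h ` S" by (rule image_eqI)
    qed
    show "map_prod h h ` S \<subseteq> {J \<in> R'. \<nu>' J \<noteq> 0}"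
    proof
      fix J assume "J \<in> map_prod h h ` S"
      then obtain a b where "(a, b) \<in> S" "J = (h a, h b)" by auto
      then show "J \<in> {J \<in> R'. \<nu>' J \<noteq> 0}"
        using SE by (auto simp: R'_def \<nu>'_def S_def)
    qed
  qed
  have inj: "inj_on (map_prod h h) S"
    by (rule inj_on_subset[OF map_prod_inj_on[OF h h] SE])
  have supp_eq: "map_prod (f \<circ> k) (f \<circ> k) (map_prod h h J) = map_prod f f J" if "J \<in> S"
    for J and f :: "'r \<Rightarrow> 'p"
    using that SE by (cases J) auto
  have sums: "(\<Sum>J | J \<in> R' \<and> \<nu>' J \<noteq> 0 \<and> map_prod (f \<circ> k) (f \<circ> k) J = I. \<nu>' J) =
              (\<Sum>J | J \<in> R \<and> \<nu> J \<noteq> 0 \<and> map_prod f f J = I. \<nu> J)" for f :: "'r \<Rightarrow> 'p" and I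
  proof -
    have "{J. J \<in> R' \<and> \<nu>' J \<noteq> 0 \<and> map_prod (f \<circ> k) (f \<circ> k) J = I} =
          {J \<in> map_prod h h ` S. map_prod (f \<circ> k) (f \<circ> k) J = I}"
      using supp by blast
    also have "\<dots> = map_prod h h ` {J \<in> S. map_prod f f J = I}"
    proof -
      have "{x \<in> H ` A. F x = i} = H ` {x \<in> A. G x = i}"
        if "\<And>x. x \<in> A \<Longrightarrow> F (H x) = G x"
        for F :: "nat \<times> nat \<Rightarrow> 'p \<times> 'p" and G :: "'r \<times> 'r \<Rightarrow> 'p \<times> 'p" and H A i
        using that by auto
      then show ?thesis using supp_eq[of _ f] by meson
    qed
    finally have "(\<Sum>J | J \<in> R' \<and> \<nu>' J \<noteq> 0 \<and> map_prod (f \<circ> k) (f \<circ> k) J = I. \<nu>' J) =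
        (\<Sum>J \<in> {J \<in> S. map_prod f f J = I}. \<nu>' (map_prod h h J))"
      using inj_on_subset[OF inj, of "{J \<in> S. map_prod f f J = I}"]
      by (simp add: sum.reindex)
    also have "\<dots> = (\<Sum>J \<in> {J \<in> S. map_prod f f J = I}. \<nu> J)"
      using SE by (intro sum.cong) (auto simp: \<nu>'_def)
    also have "{J \<in> S. map_prod f f J = I} = {J. J \<in> R \<and> \<nu> J \<noteq> 0 \<and> map_prod f f J = I}"
      by (auto simp: S_def)
    finally show ?thesis .
  qed
  have R'k: "(k a, k b) \<in> R \<and> k a \<in> E \<and> k b \<in> E \<and> a = h (k a) \<and> b = h (k b)"
    if "(a, b) \<in> R'" for a b
    using that by (auto simp: R'_def)
  have "Partial_order R'"
  proof (rule Partial_orderI)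
    show "(a, a) \<in> R' \<and> (b, b) \<in> R'" if "(a, b) \<in> R'" for a b
      using that EF by (auto simp: R'_def)
    show "(a, c) \<in> R'" if "(a, b) \<in> R'" "(b, c) \<in> R'" for a b c
    proof -
      have "(k a, k c) \<in> R" using R'k[OF that(1)] R'k[OF that(2)] Partial_orderD(2)[OF R] by blast
      then show ?thesis unfolding R'_def using R'k[OF that(1)] R'k[OF that(2)] by blast
    qed
    show "a = b" if "(a, b) \<in> R'" "(b, a) \<in> R'" for a b
      using R'k[OF that(1)] R'k[OF that(2)] Partial_orderD(3)[OF R] by metis
  qed
  moreover have "finite {J \<in> R'. \<nu>' J \<noteq> 0}" using supp fin by (simp add: S_def)
  moreover have "\<forall>J \<in> R'. 0 \<le> \<nu>' J" using nonneg R'k by (auto simp: \<nu>'_def)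
  moreover have "order_preserving R' P (f0 \<circ> k)" "order_preserving R' P (f1 \<circ> k)"
    using f R'k unfolding order_preserving_def by auto
  ultimately have "is_matching P w0 w1 R' \<nu>' (f0 \<circ> k) (f1 \<circ> k)"
    unfolding is_matching_def sums using w by (intro conjI)
  moreover have "(\<lambda>J. (map_prod (f0 \<circ> k) (f0 \<circ> k) J, map_prod (f1 \<circ> k) (f1 \<circ> k) J)) `
        {J \<in> R'. \<nu>' J \<noteq> 0} = (\<lambda>J. (map_prod f0 f0 J, map_prod f1 f1 J)) ` {J \<in> R. \<nu> J \<noteq> 0}"
    unfolding supp S_def[symmetric] image_image
    using supp_eq[of _ f0] supp_eq[of _ f1] by (intro image_cong) auto
  ultimately show ?thesis by (rule that)
qed

lemma matching_cost_on_nat: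
  fixes R :: "'r rel"
  assumes "is_matching half_line w0 w1 R \<nu> f0 f1"
  shows "bottleneck_distance w0 w1 \<le> ereal (matching_cost R \<nu> f0 f1)"
proof -
  obtain R' :: "nat rel" and \<nu>' g0 g1
    where m: "is_matching half_line w0 w1 R' \<nu>' g0 g1"
      and im: "(\<lambda>J. (map_prod g0 g0 J, map_prod g1 g1 J)) ` {J \<in> R'. \<nu>' J \<noteq> 0} =
               (\<lambda>J. (map_prod f0 f0 J, map_prod f1 f1 J)) ` {J \<in> R. \<nu> J \<noteq> 0}"
    by (rule matching_on_nat[OF assms])
  have "(\<lambda>J. dist_bar (map_prod g0 g0 J) (map_prod g1 g1 J)) ` {J \<in> R'. \<nu>' J \<noteq> 0} =
        (\<lambda>J. dist_bar (map_prod f0 f0 J) (map_prod f1 f1 J)) ` {J \<in> R. \<nu> J \<noteq> 0}"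
    using arg_cong[OF im, of "image (\<lambda>(x, y). dist_bar x y)"] by (simp add: image_image)
  moreover have "{J \<in> R'. \<nu>' J \<noteq> 0} = {} \<longleftrightarrow> {J \<in> R. \<nu> J \<noteq> 0} = {}"
    using arg_cong[OF im, of "\<lambda>A. A = {}"] by (simp only: image_is_empty)
  ultimately have "matching_cost R' \<nu>' g0 g1 = matching_cost R \<nu> f0 f1"
    by (simp only: matching_cost_def)
  then show ?thesis
    unfolding bottleneck_distance_def using m
    by (intro Inf_lower CollectI exI[of _ R'] exI[of _ \<nu>'] exI[of _ g0] exI[of _ g1]) simp
qed

definition is_interleaving ::
    "('k, 'r) ring_scheme \<Rightarrow> real \<Rightarrow> (real, 'k, 'v) pmod \<Rightarrow> (real, 'k, 'v) pmod \<Rightarrow>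
     (real \<times> nat, 'k, 'u) pmod \<Rightarrow> bool" where
  "is_interleaving K \<epsilon> M0 M1 \<Gamma> \<longleftrightarrow>
     persistence_module K (interleaving_poset \<epsilon>) \<Gamma> \<and>
     pm_iso K half_line (pm_comp \<Gamma> (\<lambda>a. (a, 0))) M0 \<and>
     pm_iso K half_line (pm_comp \<Gamma> (\<lambda>a. (a, 1))) M1"

text \<open>
  Interleavings by vector spaces over the same type of vectors \<open>'v\<close> suffice: see
  \<open>interleaving_transport\<close>.
\<close>

definition interleaving_distance ::
    "('k, 'r) ring_scheme \<Rightarrow> (real, 'k, 'v) pmod \<Rightarrow> (real, 'k, 'v) pmod \<Rightarrow> ereal" where
  "interleaving_distance K M0 M1 =
     Inf {ereal \<epsilon> | \<epsilon>. 0 < \<epsilon> \<and>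
            (\<exists>\<Gamma> :: (real \<times> nat, 'k, 'v) pmod. is_interleaving K \<epsilon> M0 M1 \<Gamma>)}"

lemma linear_map_iff:
  "linear_map K V W T \<longleftrightarrow> vectorspace K V \<and> vectorspace K W \<and> T \<in> LinearCombinations.module_hom K V W"
  by (auto simp: linear_map_def mod_hom_def mod_hom_axioms_def vectorspace_def)

lemma linear_map_comp:
  assumes "linear_map K U V S" "linear_map K V W T"
  shows "linear_map K U W (\<lambda>x. T (S x))"
  using assms by (auto simp: linear_map_iff LinearCombinations.module_hom_def Pi_iff)

lemma linear_map_inv:
  assumes "linear_map K U V S" and b: "bij_betw S (carrier U) (carrier V)"
  shows "linear_map K V U (inv_into (carrier U) S)"
proof -
  interpret linear_map K U V S by fact
  let ?g = "inv_into (carrier U) S"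
  have g: "?g y \<in> carrier U" "S (?g y) = y" if "y \<in> carrier V" for y
    using that b by (auto simp: bij_betw_def inv_into_into f_inv_into_f)
  have gI: "?g y = x" if "x \<in> carrier U" "S x = y" for x y
    using that b by (auto simp: bij_betw_def)
  have "?g \<in> LinearCombinations.module_hom K V U"
    unfolding LinearCombinations.module_hom_def by (auto intro!: gI simp: g)
  then show ?thesis using assms(1) by (simp add: linear_map_iff)
qed

lemma interleaving_transport:
  fixes \<Gamma> :: "(real \<times> nat, 'k, 'u) pmod" and M0 M1 :: "(real, 'k, 'v) pmod"
  assumes \<epsilon>: "0 < \<epsilon>" and M: "persistence_module K half_line M0" "persistence_module K half_line M1"
    and \<Gamma>: "is_interleaving K \<epsilon> M0 M1 \<Gamma>"
  shows "\<exists>\<Gamma>' :: (real \<times> nat, 'k, 'v) pmod. is_interleaving K \<epsilon> M0 M1 \<Gamma>'"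
proof -
  define N where "N t = (if t = (0 :: nat) then M0 else M1)" for t
  let ?P = "interleaving_poset \<epsilon>"
  define Q where "Q t \<phi> \<longleftrightarrow>
      (\<forall>a\<ge>0. linear_map K (pm_space \<Gamma> (a, t)) (pm_space (N t) a) (\<phi> a) \<and>
        bij_betw (\<phi> a) (carrier (pm_space \<Gamma> (a, t))) (carrier (pm_space (N t) a))) \<and>
      (\<forall>a b. 0 \<le> a \<longrightarrow> a \<le> b \<longrightarrow> (\<forall>x \<in> carrier (pm_space \<Gamma> (a, t)).
         \<phi> b (pm_map \<Gamma> (a, t) (b, t) x) = pm_map (N t) a b (\<phi> a x)))" for t \<phi>
  have "\<forall>t \<in> {0, 1}. \<exists>\<phi>. Q t \<phi>"
    using \<Gamma> unfolding is_interleaving_def pm_iso_def Field_half_line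
    by (auto simp: Q_def N_def pm_comp_def half_line_def)
  then obtain \<phi> where "\<forall>t \<in> {0, 1}. Q t (\<phi> t)"
    using bchoice[of "{0, 1}" Q] by blast
  then have Q: "Q t (\<phi> t)" if "t \<in> {0, 1}" for t using that by blast
  have lin: "linear_map K (pm_space \<Gamma> (a, t)) (pm_space (N t) a) (\<phi> t a)"
    and bij: "bij_betw (\<phi> t a) (carrier (pm_space \<Gamma> (a, t))) (carrier (pm_space (N t) a))"
    if "t \<in> {0, 1}" "0 \<le> a" for a t
    using Q[OF that(1)] that(2) by (simp_all add: Q_def)
  have nat: "\<phi> t b (pm_map \<Gamma> (a, t) (b, t) x) = pm_map (N t) a b (\<phi> t a x)"
    if "t \<in> {0, 1}" "0 \<le> a" "a \<le> b" "x \<in> carrier (pm_space \<Gamma> (a, t))" for a b t x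
    using Q[OF that(1)] that(2-) by (simp add: Q_def)
  define \<psi> where "\<psi> t a = inv_into (carrier (pm_space \<Gamma> (a, t))) (\<phi> t a)" for t a
  have \<psi>lin: "linear_map K (pm_space (N t) a) (pm_space \<Gamma> (a, t)) (\<psi> t a)"
    if "t \<in> {0, 1}" "0 \<le> a" for a t
    unfolding \<psi>_def using linear_map_inv[OF lin bij] that by blast
  have \<psi>: "\<psi> t a x \<in> carrier (pm_space \<Gamma> (a, t))" "\<phi> t a (\<psi> t a x) = x"
    if "t \<in> {0, 1}" "0 \<le> a" "x \<in> carrier (pm_space (N t) a)" for a t x
    using that bij[OF that(1,2)]
    by (auto simp: \<psi>_def bij_betw_def inv_into_into f_inv_into_f)
  have \<phi>: "\<psi> t a (\<phi> t a x) = x"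
    if "t \<in> {0, 1}" "0 \<le> a" "x \<in> carrier (pm_space \<Gamma> (a, t))" for a t x
    using that bij[OF that(1,2)] by (simp add: \<psi>_def bij_betw_def)
  define \<Gamma>' :: "(real \<times> nat, 'k, 'v) pmod" where "\<Gamma>' =
    \<lparr>pm_space = (\<lambda>(a, t). pm_space (N t) a),
     pm_map = (\<lambda>(a, t) (b, s) x. \<phi> s b (pm_map \<Gamma> (a, t) (b, s) (\<psi> t a x)))\<rparr>"
  have pmN: "persistence_module K half_line (N t)" for t using M by (simp add: N_def)
  have pm\<Gamma>: "persistence_module K ?P \<Gamma>" using \<Gamma> by (simp add: is_interleaving_def)
  have \<Gamma>lin: "linear_map K (pm_space \<Gamma> p) (pm_space \<Gamma> q) (pm_map \<Gamma> p q)" if "(p, q) \<in> ?P" for p q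
    using pm\<Gamma> that unfolding persistence_module_def by blast
  then have \<Gamma>im: "pm_map \<Gamma> p q x \<in> carrier (pm_space \<Gamma> q)"
    if "(p, q) \<in> ?P" "x \<in> carrier (pm_space \<Gamma> p)" for p q x
    using that by (auto simp: linear_map_iff LinearCombinations.module_hom_def Pi_iff)
  have \<Gamma>comp: "pm_map \<Gamma> q r (pm_map \<Gamma> p q x) = pm_map \<Gamma> p r x"
    if "(p, q) \<in> ?P" "(q, r) \<in> ?P" "x \<in> carrier (pm_space \<Gamma> p)" for p q r x
    using pm\<Gamma> that unfolding persistence_module_def by blast
  have \<Gamma>id: "pm_map \<Gamma> p p x = x" if "p \<in> Field ?P" "x \<in> carrier (pm_space \<Gamma> p)" for p x
    using pm\<Gamma> that unfolding persistence_module_def by blast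
  have PD: "0 \<le> a" "0 \<le> b" "t \<in> {0, 1}" "s \<in> {0, 1}" if "((a, t), (b, s)) \<in> ?P" for a b t s
    using that by (auto simp: interleaving_poset_def)
  have "persistence_module K ?P \<Gamma>'"
    unfolding persistence_module_def
  proof (intro conjI ballI allI impI)
    fix p assume "p \<in> Field ?P"
    then obtain a t where p: "p = (a, t)" "0 \<le> a" "t \<in> {0, 1}"
      unfolding Field_interleaving_poset by auto
    then show "vectorspace K (pm_space \<Gamma>' p)" "vectorspace.fin_dim K (pm_space \<Gamma>' p)"
      using pmN[of t] by (simp_all add: \<Gamma>'_def persistence_module_def Field_half_line)
    show "pm_map \<Gamma>' p p x = x" if "x \<in> carrier (pm_space \<Gamma>' p)" for x
      using that p \<psi>[of t a x] \<Gamma>id[OF \<open>p \<in> Field ?P\<close>] by (simp add: \<Gamma>'_def)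
  next
    fix p q assume pq: "(p, q) \<in> ?P"
    obtain a t b s where [simp]: "p = (a, t)" "q = (b, s)" by (cases p, cases q)
    note D = PD[OF pq[simplified]]
    show "linear_map K (pm_space \<Gamma>' p) (pm_space \<Gamma>' q) (pm_map \<Gamma>' p q)"
      using linear_map_comp[OF linear_map_comp[OF \<psi>lin[OF D(3,1)] \<Gamma>lin[OF pq[simplified]]] lin[OF D(4,2)]]
      by (simp add: \<Gamma>'_def)
    fix r x assume qr: "(q, r) \<in> ?P" and x: "x \<in> carrier (pm_space \<Gamma>' p)"
    obtain c u where [simp]: "r = (c, u)" by (cases r)
    have y: "\<psi> t a x \<in> carrier (pm_space \<Gamma> p)" using \<psi>(1)[OF D(3,1)] x by (simp add: \<Gamma>'_def)
    show "pm_map \<Gamma>' q r (pm_map \<Gamma>' p q x) = pm_map \<Gamma>' p r x"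
      using \<phi>[OF D(4,2)] \<Gamma>im[OF pq y] \<Gamma>comp[OF pq qr y] by (simp add: \<Gamma>'_def)
  qed
  moreover have "pm_iso K half_line (pm_comp \<Gamma>' (\<lambda>a. (a, t))) (N t)" if t: "t \<in> {0, 1}" for t
    unfolding pm_iso_def
  proof (intro exI[of _ "\<lambda>a x. x"] conjI ballI allI impI)
    fix a assume "a \<in> Field half_line"
    then have "0 \<le> a" by (simp add: Field_half_line)
    have "vectorspace K (pm_space (N t) a)"
      using pmN[of t] \<open>a \<in> Field half_line\<close> by (simp add: persistence_module_def)
    then show "linear_map K (pm_space (pm_comp \<Gamma>' (\<lambda>a. (a, t))) a) (pm_space (N t) a) (\<lambda>x. x)"
      by (simp add: linear_map_iff LinearCombinations.module_hom_def pm_comp_def \<Gamma>'_def)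
    show "bij_betw (\<lambda>x. x) (carrier (pm_space (pm_comp \<Gamma>' (\<lambda>a. (a, t))) a))
        (carrier (pm_space (N t) a))"
      by (simp add: pm_comp_def \<Gamma>'_def bij_betw_def)
  next
    fix a b x assume "(a, b) \<in> half_line" and x: "x \<in> carrier (pm_space (pm_comp \<Gamma>' (\<lambda>a. (a, t))) a)"
    then have ab: "0 \<le> a" "a \<le> b" by (auto simp: half_line_def)
    have "x \<in> carrier (pm_space (N t) a)" using x by (simp add: pm_comp_def \<Gamma>'_def)
    then show "pm_map (pm_comp \<Gamma>' (\<lambda>a. (a, t))) a b x = pm_map (N t) a b x"
      using nat[OF t ab] \<psi>[OF t ab(1)] by (simp add: pm_comp_def \<Gamma>'_def)
  qed
  then have "pm_iso K half_line (pm_comp \<Gamma>' (\<lambda>a. (a, 0))) M0"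
    "pm_iso K half_line (pm_comp \<Gamma>' (\<lambda>a. (a, 1))) M1"
    by (force simp: N_def)+
  ultimately show ?thesis unfolding is_interleaving_def by blast
qed

end

theory Submission
  imports Defs "Jordan_Normal_Form.DL_Rank"
begin

text \<open>
  Everything is read off from the ranks of the structure maps of an \<open>\<epsilon>\<close>-interleaving \<open>\<Gamma>\<close>, and the
  only linear algebra is Frobenius' inequality (\<open>rank_frobenius\<close>): for \<open>p \<le> q \<le> r \<le> s\<close> the image of
  \<open>p \<rightarrow> r\<close> lies in that of \<open>q \<rightarrow> r\<close>, and the larger space loses at least as much dimension under
  \<open>r \<rightarrow> s\<close> as the smaller one.

  Between \<open>M0\<close> and \<open>M1\<close> stands the module \<open>I\<close> whose value at \<open>a\<close> is the image of
  \<open>\<Gamma> (a, 0) \<rightarrow> \<Gamma> (a + \<epsilon>, 1)\<close>. It is a quotient of \<open>M0\<close> and a submodule of \<open>M1\<close> shifted by \<open>\<epsilon>\<close>, and its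
  rank from \<open>a\<close> to \<open>b\<close> is the rank of \<open>\<Gamma> (a, 0) \<rightarrow> \<Gamma> (b + \<epsilon>, 1)\<close>, so that \<open>I\<close> itself need not be
  constructed. A quotient keeps births and lets bars die earlier; a submodule keeps deaths and lets
  bars be born later. Because \<open>\<Gamma>\<close> also contains the maps from \<open>M1\<close> back to \<open>M0\<close>, both effects are
  bounded by \<open>2 \<epsilon>\<close>. In terms of ranks these are four instances of Frobenius' inequality.

  Among the bars born at one time, these bounds say that the sorted lists of deaths in \<open>M0\<close> and \<open>I\<close>
  are entrywise close, except that \<open>M0\<close> may have additional bars of length at most \<open>2 \<epsilon>\<close>; likewise
  for \<open>I\<close> and \<open>M1\<close> among the bars with one time of death (\<open>keyed_matching\<close>, \<open>match_births\<close>,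
  \<open>match_deaths\<close>). Composing the two matchings along the bars of \<open>I\<close>, and sending the remaining short
  bars to the diagonal points over their midpoints, gives a matching of cost at most \<open>\<epsilon>\<close>
  (\<open>bottleneck_le_of_rank_functions\<close>). Bars that never die do not occur in the diagrams
  but do contribute to ranks; they cancel because \<open>M0\<close> and \<open>I\<close> have equally many of them
  born at any given time.

  The bars themselves come from Moebius inversion. Constructibility makes the rank functions constant
  between the points of a finite grid, so the inversion exists and is supported on the grid; its sum
  over a rectangle above the diagonal is an alternating sum of four ranks, which Frobenius'
  inequality makes nonnegative (\<open>barcode\<close>).
\<close>

section \<open>Ranks of linear maps\<close>

text \<open>A linearly independent set of largest possible size in the subspace spans it; sizes are
  bounded by the dimension of the whole space.\<close>

lemma (in vectorspace) subspace_fin_dim: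
  assumes W: "VectorSpace.subspace K W V" and fd: "fin_dim"
  shows "vectorspace.fin_dim K (vs W)"
proof -
  interpret W: vectorspace K "vs W" by (rule subspace_is_vs[OF W])
  have sub: "submodule K W V" using W by (rule is_module)
  then have WV: "W \<subseteq> carrier V" by (simp add: submodule_def)
  let ?P = "\<lambda>S. S \<subseteq> carrier (vs W) \<and> W.lin_indpt S"
  have "finite S \<and> card S \<le> dim" if "?P S" for S
  proof -
    have "lin_indpt S" using that span_li_not_depend(2)[OF _ sub, of S] by simp
    moreover have "S \<subseteq> carrier V" using that WV by auto
    ultimately show ?thesis using li_le_dim[OF fd] by blast
  qed
  moreover have "?P {}" by (simp add: W.lin_dep_def)
  ultimately obtain S where "finite S" "maximal S ?P"
    using maximal_exists[of ?P dim "{}"] by blast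
  then have "W.basis S" by (intro W.max_li_is_basis)
  then show ?thesis using \<open>finite S\<close> unfolding W.fin_dim_def W.basis_def by blast
qed

lemma (in vectorspace) subspace_dim_mono:
  assumes A: "VectorSpace.subspace K A V" and B: "VectorSpace.subspace K B V" and fd: "fin_dim" and "A \<subseteq> B"
  shows "vectorspace.dim K (vs A) \<le> vectorspace.dim K (vs B)"
proof -
  interpret B: vectorspace K "vs B" by (rule subspace_is_vs[OF B])
  have AB: "VectorSpace.subspace K A (vs B)" by (rule nested_subspaces[OF B A \<open>A \<subseteq> B\<close>])
  have "vectorspace.fin_dim K (vs A)" by (rule subspace_fin_dim[OF A fd])
  then show ?thesis
    using B.subspace_dim[OF AB subspace_fin_dim[OF B fd]] by simp
qed

context linear_map
begin

lemma restrict_linear_map: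
  assumes A: "VectorSpace.subspace K A V"
  shows "linear_map K (V.vs A) W T"
proof -
  interpret A: vectorspace K "V.vs A" by (rule V.subspace_is_vs[OF A])
  have AV: "x \<in> carrier V" if "x \<in> A" for x
    using V.is_module[OF A] that by (auto simp: submodule_def)
  have "T \<in> LinearCombinations.module_hom K (V.vs A) W"
    unfolding LinearCombinations.module_hom_def by (simp add: AV Pi_iff)
  then show ?thesis
    by (simp add: linear_map_iff A.vectorspace_axioms W.vectorspace_axioms)
qed

lemma image_subspace:
  assumes A: "VectorSpace.subspace K A V"
  shows "VectorSpace.subspace K (T ` A) W"
proof -
  interpret A: linear_map K "V.vs A" W T by (rule restrict_linear_map[OF A])
  show ?thesis using A.imT_is_subspace by (simp add: A.im_def)
qed

lemma rank_nullity_on: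
  assumes A: "VectorSpace.subspace K A V" and fd: "V.fin_dim"
  shows "vectorspace.dim K (V.vs A) =
    vectorspace.dim K (W.vs (T ` A)) + vectorspace.dim K (V.vs {v \<in> A. T v = \<zero>\<^bsub>W\<^esub>})"
proof -
  interpret A: linear_map K "V.vs A" W T by (rule restrict_linear_map[OF A])
  show ?thesis
    using A.rank_nullity[OF V.subspace_fin_dim[OF A fd]] by (simp add: A.im_def A.ker_def)
qed

lemma kernel_on_subspace:
  assumes A: "VectorSpace.subspace K A V"
  shows "VectorSpace.subspace K {v \<in> A. T v = \<zero>\<^bsub>W\<^esub>} V"
proof -
  have "submodule K A V" by (rule V.is_module[OF A])
  then have "submodule K {v \<in> A. T v = \<zero>\<^bsub>W\<^esub>} V"
    unfolding submodule_def by (auto simp: subset_iff)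
  then show ?thesis using V.vectorspace_axioms by (simp add: VectorSpace.subspace_def)
qed

lemma dim_image_on_le:
  assumes A: "VectorSpace.subspace K A V" and fd: "V.fin_dim"
  shows "vectorspace.dim K (W.vs (T ` A)) \<le> vectorspace.dim K (V.vs A)"
  using rank_nullity_on[OF A fd] by simp

text \<open>The loss of dimension is the dimension of the part of the kernel that lies in the subspace,
  which grows with the subspace.\<close>

lemma dim_image_loss_mono:
  assumes A: "VectorSpace.subspace K A V" and B: "VectorSpace.subspace K B V" and fd: "V.fin_dim" and "A \<subseteq> B"
  shows "vectorspace.dim K (W.vs (T ` B)) + vectorspace.dim K (V.vs A) \<le>
    vectorspace.dim K (V.vs B) + vectorspace.dim K (W.vs (T ` A))"
proof -
  have "vectorspace.dim K (V.vs {v \<in> A. T v = \<zero>\<^bsub>W\<^esub>}) \<le>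
      vectorspace.dim K (V.vs {v \<in> B. T v = \<zero>\<^bsub>W\<^esub>})"
    using \<open>A \<subseteq> B\<close> by (intro V.subspace_dim_mono kernel_on_subspace A B fd) auto
  then show ?thesis using rank_nullity_on[OF A fd] rank_nullity_on[OF B fd] by simp
qed

lemma dim_image_bij:
  assumes bij: "bij_betw T (carrier V) (carrier W)" and A: "VectorSpace.subspace K A V" and fd: "V.fin_dim"
  shows "vectorspace.dim K (W.vs (T ` A)) = vectorspace.dim K (V.vs A)"
proof -
  interpret A: linear_map K "V.vs A" W T by (rule restrict_linear_map[OF A])
  have "A \<subseteq> carrier V" using V.is_module[OF A] by (simp add: submodule_def)
  then have "inj_on T (carrier (V.vs A))"
    using bij by (auto simp: bij_betw_def intro: inj_on_subset)
  then show ?thesis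
    using A.rank_nullity[OF V.subspace_fin_dim[OF A fd]] A.inj_imp_dim_ker0
    by (simp add: A.im_def)
qed

end

section \<open>The rank function of a persistence module\<close>

definition pm_rank :: "('k, 'r) ring_scheme \<Rightarrow> ('p, 'k, 'v) pmod \<Rightarrow> 'p \<Rightarrow> 'p \<Rightarrow> nat" where
  "pm_rank K M p q = vectorspace.dim K
     ((pm_space M q)\<lparr>carrier := pm_map M p q ` carrier (pm_space M p)\<rparr>)"

text \<open>The record fields \<open>pm_space\<close> and \<open>pm_map\<close> carry junk off the poset, so every fact below is
  relative to comparable pairs.\<close>

locale persistence =
  fixes K :: "('k, 'r) ring_scheme" and P :: "'p rel" and M :: "('p, 'k, 'v) pmod"
  assumes P: "Partial_order P" and M: "persistence_module K P M"
begin

lemma vectorspace_at: "p \<in> Field P \<Longrightarrow> vectorspace K (pm_space M p)"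
  and fin_dim_at: "p \<in> Field P \<Longrightarrow> vectorspace.fin_dim K (pm_space M p)"
  and linear_map_at: "(p, q) \<in> P \<Longrightarrow> linear_map K (pm_space M p) (pm_space M q) (pm_map M p q)"
  and map_id: "p \<in> Field P \<Longrightarrow> x \<in> carrier (pm_space M p) \<Longrightarrow> pm_map M p p x = x"
  and map_comp: "(p, q) \<in> P \<Longrightarrow> (q, r) \<in> P \<Longrightarrow> x \<in> carrier (pm_space M p) \<Longrightarrow>
    pm_map M q r (pm_map M p q x) = pm_map M p r x"
  using M unfolding persistence_module_def by blast+

definition img :: "'p \<Rightarrow> 'p \<Rightarrow> 'v set" where
  "img p q = pm_map M p q ` carrier (pm_space M p)"

lemma rank_img: "pm_rank K M p q = vectorspace.dim K ((pm_space M q)\<lparr>carrier := img p q\<rparr>)"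
  by (simp add: pm_rank_def img_def)

lemma img_subspace:
  assumes "(p, q) \<in> P" shows "VectorSpace.subspace K (img p q) (pm_space M q)"
proof -
  interpret linear_map K "pm_space M p" "pm_space M q" "pm_map M p q"
    by (rule linear_map_at[OF assms])
  show ?thesis using imT_is_subspace by (simp add: im_def img_def)
qed

lemma img_map:
  assumes "(p, q) \<in> P" "(q, r) \<in> P"
  shows "pm_map M q r ` img p q = img p r"
  using map_comp[OF assms] by (force simp: img_def)

lemma map_in_carrier:
  assumes "(p, q) \<in> P" "x \<in> carrier (pm_space M p)"
  shows "pm_map M p q x \<in> carrier (pm_space M q)"
  using linear_map_at[OF assms(1)] assms(2)
  by (auto simp: linear_map_iff LinearCombinations.module_hom_def Pi_iff)

lemma img_mono:
  assumes "(p, q) \<in> P" "(q, r) \<in> P"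
  shows "img p r \<subseteq> img q r"
  using map_comp[OF assms] map_in_carrier[OF assms(1)] by (force simp: img_def)

lemma in_Field: "(p, q) \<in> P \<Longrightarrow> p \<in> Field P" "(p, q) \<in> P \<Longrightarrow> q \<in> Field P"
  by (auto simp: Field_def)

text \<open>For matrices this is Frobenius' inequality
  \<open>rank (A B) + rank (B C) \<le> rank B + rank (A B C)\<close>, with \<open>B\<close> the map from \<open>q\<close> to \<open>r\<close>.\<close>

lemma rank_frobenius:
  assumes "(p, q) \<in> P" "(q, r) \<in> P" "(r, s) \<in> P"
  shows "pm_rank K M q s + pm_rank K M p r \<le> pm_rank K M q r + pm_rank K M p s"
proof -
  have pr: "(p, r) \<in> P" using Partial_orderD(2)[OF P] assms by blast
  interpret linear_map K "pm_space M r" "pm_space M s" "pm_map M r s"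
    by (rule linear_map_at[OF assms(3)])
  show ?thesis
    using dim_image_loss_mono[OF img_subspace[OF pr] img_subspace[OF assms(2)]
        fin_dim_at[OF in_Field(1)[OF assms(3)]] img_mono[OF assms(1,2)]]
    by (simp add: rank_img img_map[OF pr assms(3)] img_map[OF assms(2,3)])
qed

lemma rank_mono_left:
  assumes "(p, q) \<in> P" "(q, r) \<in> P"
  shows "pm_rank K M p r \<le> pm_rank K M q r"
proof -
  have pr: "(p, r) \<in> P" using Partial_orderD(2)[OF P] assms by blast
  interpret vectorspace K "pm_space M r" by (rule vectorspace_at[OF in_Field(2)[OF pr]])
  show ?thesis unfolding rank_img
    by (intro subspace_dim_mono img_subspace pr assms img_mono
        fin_dim_at in_Field(2)[OF pr])
qed

lemma rank_mono_right:
  assumes "(p, q) \<in> P" "(q, r) \<in> P"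
  shows "pm_rank K M p r \<le> pm_rank K M p q"
proof -
  interpret linear_map K "pm_space M q" "pm_space M r" "pm_map M q r"
    by (rule linear_map_at[OF assms(2)])
  show ?thesis
    using dim_image_on_le[OF img_subspace[OF assms(1)] fin_dim_at[OF in_Field(1)[OF assms(2)]]]
    by (simp add: rank_img img_map[OF assms])
qed

lemma img_refl: "p \<in> Field P \<Longrightarrow> img p p = carrier (pm_space M p)"
  using map_id by (simp add: img_def)

lemma rank_refl: "p \<in> Field P \<Longrightarrow> pm_rank K M p p = vectorspace.dim K (pm_space M p)"
  by (simp add: rank_img img_refl)

lemma nullity_eq_rank:
  assumes "(p, q) \<in> P"
  shows "nullity K M (p, q) = int (pm_rank K M p p) - int (pm_rank K M p q)"
proof -
  interpret linear_map K "pm_space M p" "pm_space M q" "pm_map M p q"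
    by (rule linear_map_at[OF assms])
  show ?thesis
    using rank_nullity[OF fin_dim_at[OF in_Field(1)[OF assms]]]
    by (simp add: nullity_def rank_refl[OF in_Field(1)[OF assms]] rank_img[of p q] img_def im_def)
qed

lemma rank_eq_if_bij:
  assumes "(p, q) \<in> P"
    and bij: "bij_betw (pm_map M p q) (carrier (pm_space M p)) (carrier (pm_space M q))"
  shows "pm_rank K M p q = pm_rank K M p p" "pm_rank K M p q = pm_rank K M q q"
proof -
  interpret linear_map K "pm_space M p" "pm_space M q" "pm_map M p q"
    by (rule linear_map_at[OF assms(1)])
  have im: "img p q = carrier (pm_space M q)" using bij by (simp add: img_def bij_betw_def)
  show *: "pm_rank K M p q = pm_rank K M q q"
    by (simp add: rank_img im img_refl in_Field(2)[OF assms(1)])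
  have "V.dim = W.dim" using bij
    by (intro dim_eq fin_dim_at in_Field(1)[OF assms(1)]) (auto simp: bij_betw_def)
  then show "pm_rank K M p q = pm_rank K M p p"
    by (simp add: * rank_refl in_Field[OF assms(1)])
qed

text \<open>If the map from \<open>p\<close> to \<open>q\<close> has full rank at both ends, it is an isomorphism, and \<open>p\<close> and \<open>q\<close>
  cannot be told apart by ranks. Both parts are Frobenius' inequality with a degenerate chain.\<close>

lemma rank_step:
  assumes pq: "(p, q) \<in> P" and bij: "pm_rank K M p q = pm_rank K M p p" "pm_rank K M p q = pm_rank K M q q"
  shows "(q, r) \<in> P \<Longrightarrow> pm_rank K M p r = pm_rank K M q r"
    and "(r, p) \<in> P \<Longrightarrow> pm_rank K M r p = pm_rank K M r q"
proof -
  note refl = Partial_orderD(1)[OF P]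
  show "pm_rank K M p r = pm_rank K M q r" if "(q, r) \<in> P"
    using rank_frobenius[OF pq refl[OF in_Field(2)[OF pq]] that] rank_mono_left[OF pq that] bij
    by linarith
  show "pm_rank K M r p = pm_rank K M r q" if "(r, p) \<in> P"
    using rank_frobenius[OF that refl[OF in_Field(1)[OF pq]] pq] rank_mono_right[OF that pq] bij
    by linarith
qed

end

lemma rank_pm_iso:
  assumes P: "(p, q) \<in> P" and M: "persistence_module K P M"
    and iso: "pm_iso K P M N"
  shows "pm_rank K N p q = pm_rank K M p q"
proof -
  obtain \<phi> where lin: "\<And>a. a \<in> Field P \<Longrightarrow> linear_map K (pm_space M a) (pm_space N a) (\<phi> a)"
    and bij: "\<And>a. a \<in> Field P \<Longrightarrow> bij_betw (\<phi> a) (carrier (pm_space M a)) (carrier (pm_space N a))"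
    and nat: "\<And>a b x. (a, b) \<in> P \<Longrightarrow> x \<in> carrier (pm_space M a) \<Longrightarrow>
      \<phi> b (pm_map M a b x) = pm_map N a b (\<phi> a x)"
    using iso unfolding pm_iso_def by metis
  have F: "p \<in> Field P" "q \<in> Field P" using P by (auto simp: Field_def)
  interpret M: linear_map K "pm_space M p" "pm_space M q" "pm_map M p q"
    using M P unfolding persistence_module_def by blast
  interpret linear_map K "pm_space M q" "pm_space N q" "\<phi> q" by (rule lin[OF F(2)])
  let ?I = "pm_map M p q ` carrier (pm_space M p)"
  have "\<phi> q ` ?I = pm_map N p q ` \<phi> p ` carrier (pm_space M p)"
    using nat[OF P] by (force simp: image_image)
  then have im: "\<phi> q ` ?I = pm_map N p q ` carrier (pm_space N p)"
    using bij[OF F(1)] by (simp add: bij_betw_def)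
  have "VectorSpace.subspace K ?I (pm_space M q)" using M.imT_is_subspace by (simp add: M.im_def)
  moreover have "vectorspace.fin_dim K (pm_space M q)"
    using M F unfolding persistence_module_def by blast
  ultimately have "vectorspace.dim K ((pm_space N q)\<lparr>carrier := \<phi> q ` ?I\<rparr>) =
      vectorspace.dim K ((pm_space M q)\<lparr>carrier := ?I\<rparr>)"
    by (rule dim_image_bij[OF bij[OF F(2)]])
  then show ?thesis by (simp only: pm_rank_def im)
qed

text \<open>Constructibility gives isomorphisms between values, and these are the structure maps
  themselves because a co-closure operator sends the two ends of such a pair to one point.\<close>

lemma constructible_bij:
  assumes P: "(p, q) \<in> P" and iso: "pm_iso K P (pm_comp M c) M" and M: "persistence_module K P M"
    and c: "c p = c q" "c p \<in> Field P"
  shows "bij_betw (pm_map M p q) (carrier (pm_space M p)) (carrier (pm_space M q))"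
proof -
  obtain \<phi> where 
    bij: "\<And>a. a \<in> Field P \<Longrightarrow> bij_betw (\<phi> a) (carrier (pm_space M (c a))) (carrier (pm_space M a))"
    and nat: "\<And>a b x. (a, b) \<in> P \<Longrightarrow> x \<in> carrier (pm_space M (c a)) \<Longrightarrow>
      \<phi> b (pm_map M (c a) (c b) x) = pm_map M a b (\<phi> a x)"
    using iso unfolding pm_iso_def pm_comp_def pmod.simps by metis
  have F: "p \<in> Field P" "q \<in> Field P" using P by (auto simp: Field_def)
  have id: "pm_map M (c p) (c p) x = x" if "x \<in> carrier (pm_space M (c p))" for x
    using M that c(2) unfolding persistence_module_def by blast
  have "bij_betw (pm_map M p q \<circ> \<phi> p) (carrier (pm_space M (c p))) (carrier (pm_space M q))"
    using bij[OF F(2)] nat[OF P] id c by (subst bij_betw_cong[of _ _ "\<phi> q"]) auto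
  then show ?thesis using bij[OF F(1)] by (simp add: bij_betw_comp_iff[symmetric])
qed

text \<open>The grid is the image of the co-closure operator \<open>c\<close>: if it has no point in \<open>(a, b]\<close>, then
  \<open>c b \<le> a\<close>, whence \<open>c b = c (c b) \<le> c a\<close>.\<close>

lemma constructible_steps:
  assumes M: "persistence_module K half_line M" and "constructible K half_line M"
  obtains G where "finite G" "0 \<in> G" "G \<subseteq> {0..}"
    "\<And>a b. 0 \<le> a \<Longrightarrow> a \<le> b \<Longrightarrow> G \<inter> {a<..b} = {} \<Longrightarrow>
      bij_betw (pm_map M a b) (carrier (pm_space M a)) (carrier (pm_space M b))"
proof -
  obtain c where c: "co_closure_operator half_line c" "finite (c ` {0..})"
    "pm_iso K half_line (pm_comp M c) M"
    using assms(2) unfolding constructible_def Field_half_line by blast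
  have mono: "c a \<le> c b" "0 \<le> c a" if "0 \<le> a" "a \<le> b" for a b
    using c(1) that by (auto simp: co_closure_operator_def order_preserving_def half_line_def)
  have le: "c a \<le> a" "c (c a) = c a" if "0 \<le> a" for a
    using c(1) that by (auto simp: co_closure_operator_def half_line_def Field_half_line[unfolded half_line_def])
  show ?thesis
  proof (rule that[of "c ` {0..}"])
    show "finite (c ` {0..})" by fact
    show "0 \<in> c ` {0..}" using le(1)[of 0] mono(2)[of 0 0] by (force intro!: image_eqI[of _ _ 0])
    show "c ` {0..} \<subseteq> {0..}" using mono by auto
    fix a b assume ab: "0 \<le> a" "a \<le> (b :: real)" and disj: "c ` {0..} \<inter> {a<..b} = {}"
    have "c b \<in> c ` {0..}" "c b \<le> b" using ab le(1)[of b] by auto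
    then have "c b \<le> a" using disj by (meson disjoint_iff greaterThanAtMost_iff not_le)
    then have "c b \<le> c a" using mono(1)[of "c b" a] mono(2)[of b b] le(2)[of b] ab by auto
    then have "c a = c b" using mono(1)[OF ab] by simp
    then show "bij_betw (pm_map M a b) (carrier (pm_space M a)) (carrier (pm_space M b))"
      using ab mono(2)[OF ab] by (intro constructible_bij[OF _ c(3) M])
        (auto simp: half_line_def Field_half_line[unfolded half_line_def])
  qed
qed

section \<open>Existence of Moebius inversions\<close>

text \<open>By induction on the size of \<open>Q\<close>, removing a maximal element \<open>z\<close>: the value at \<open>z\<close> enters only
  the equation at \<open>z\<close>, which determines it.\<close>

lemma moebius_inversion_on_finite:
  fixes n :: "'x \<Rightarrow> int"
  assumes X: "Partial_order X" and "finite Q" "Q \<subseteq> Field X"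
  obtains d where "\<And>x. x \<notin> Q \<Longrightarrow> d x = 0"
    and "\<And>y. y \<in> Q \<Longrightarrow> n y = (\<Sum>x | x \<in> Q \<and> (x, y) \<in> X. d x)"
proof -
  have "\<exists>d. (\<forall>x. x \<notin> Q \<longrightarrow> d x = 0) \<and> (\<forall>y\<in>Q. n y = (\<Sum>x | x \<in> Q \<and> (x, y) \<in> X. d x))"
    using assms(2,3)
  proof (induction "card Q" arbitrary: Q)
    case 0
    then show ?case by (intro exI[of _ "\<lambda>_. 0"]) auto
  next
    case (Suc k)
    then have ne: "Q \<noteq> {}" by auto
    have "\<exists>z\<in>Q. \<forall>x\<in>Q. (z, x) \<in> X \<longrightarrow> x = z"
    proof -
      have "asymp_on Q (\<lambda>a b. (a, b) \<in> X \<and> a \<noteq> b)"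
        by (auto intro!: asymp_onI dest: Partial_orderD(3)[OF X])
      moreover have "transp_on Q (\<lambda>a b. (a, b) \<in> X \<and> a \<noteq> b)"
        by (rule transp_onI) (meson Partial_orderD(2,3)[OF X])
      ultimately show ?thesis
        using Finite_Set.bex_max_element[OF \<open>finite Q\<close>] ne by blast
    qed
    then obtain z where z: "z \<in> Q" "\<And>x. x \<in> Q \<Longrightarrow> (z, x) \<in> X \<Longrightarrow> x = z" by blast
    have "card (Q - {z}) = k" "finite (Q - {z})" "Q - {z} \<subseteq> Field X"
      using Suc z by auto
    then obtain d where d: "\<And>x. x \<notin> Q - {z} \<Longrightarrow> d x = 0"
      "\<And>y. y \<in> Q - {z} \<Longrightarrow> n y = (\<Sum>x | x \<in> Q - {z} \<and> (x, y) \<in> X. d x)"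
      using Suc.hyps(1)[of "Q - {z}"] by blast
    let ?s = "\<Sum>x | x \<in> Q - {z} \<and> (x, z) \<in> X. d x"
    have zz: "(z, z) \<in> X" using z(1) Suc.prems Partial_orderD(1)[OF X] by blast
    show ?case
    proof (intro exI[of _ "d(z := n z - ?s)"] conjI allI impI ballI)
      fix x assume "x \<notin> Q"
      then show "(d(z := n z - ?s)) x = 0" using d(1) z(1) by auto
    next
      fix y assume y: "y \<in> Q"
      show "n y = (\<Sum>x | x \<in> Q \<and> (x, y) \<in> X. (d(z := n z - ?s)) x)"
      proof (cases "y = z")
        case True
        have "{x. x \<in> Q \<and> (x, z) \<in> X} = insert z {x. x \<in> Q - {z} \<and> (x, z) \<in> X}"
          using z(1) zz by auto
        moreover have "(\<Sum>x | x \<in> Q - {z} \<and> (x, z) \<in> X. (d(z := n z - ?s)) x) = ?s"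
          by (intro sum.cong) auto
        ultimately show ?thesis using True Suc.prems(1) by simp
      next
        case False
        then have "(z, y) \<notin> X" using z(2) y by auto
        then have "{x. x \<in> Q \<and> (x, y) \<in> X} = {x. x \<in> Q - {z} \<and> (x, y) \<in> X}" by auto
        moreover have "(\<Sum>x | x \<in> Q - {z} \<and> (x, y) \<in> X. (d(z := n z - ?s)) x) =
            (\<Sum>x | x \<in> Q - {z} \<and> (x, y) \<in> X. d x)"
          by (intro sum.cong) auto
        ultimately show ?thesis using d(2) y False by simp
      qed
    qed
  qed
  then show ?thesis using that by blast
qed

text \<open>The hypothesis says that \<open>n\<close> is determined by the greatest element of \<open>Q\<close> below the argument, so
  the inversion on the finite poset \<open>Q\<close>, extended by zero, serves for all of \<open>X\<close>.\<close>

lemma moebius_inversion_exists: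
  fixes n :: "'x \<Rightarrow> int"
  assumes X: "Partial_order X" and Q: "finite Q" "Q \<subseteq> Field X"
    and floor: "\<And>y. y \<in> Field X \<Longrightarrow> \<exists>z\<in>Q. (z, y) \<in> X \<and> n z = n y \<and>
      (\<forall>x\<in>Q. (x, y) \<in> X \<longrightarrow> (x, z) \<in> X)"
  obtains d where "is_moebius_inversion X n d" "{x. d x \<noteq> 0} \<subseteq> Q"
proof -
  obtain d where d: "\<And>x. x \<notin> Q \<Longrightarrow> d x = 0"
    "\<And>y. y \<in> Q \<Longrightarrow> n y = (\<Sum>x | x \<in> Q \<and> (x, y) \<in> X. d x)"
    using moebius_inversion_on_finite[OF X Q, of n] by blast
  have supp: "{x. d x \<noteq> 0} \<subseteq> Q" using d(1) by blast
  have "is_moebius_inversion X n d"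
    unfolding is_moebius_inversion_def
  proof (intro conjI ballI allI impI)
    fix y assume y: "y \<in> Field X"
    have sub: "{x. (x, y) \<in> X \<and> d x \<noteq> 0} \<subseteq> Q" using supp by blast
    then show "finite {x. (x, y) \<in> X \<and> d x \<noteq> 0}" using Q(1) by (rule finite_subset)
    obtain z where z: "z \<in> Q" "(z, y) \<in> X" "n z = n y" "\<forall>x\<in>Q. (x, y) \<in> X \<longrightarrow> (x, z) \<in> X"
      using floor[OF y] by blast
    have "{x. x \<in> Q \<and> (x, z) \<in> X} = {x. x \<in> Q \<and> (x, y) \<in> X}"
      using z Partial_orderD(2)[OF X] by blast
    then have "n y = (\<Sum>x | x \<in> Q \<and> (x, y) \<in> X. d x)" using d(2)[OF z(1)] z(3) by simp
    also have "\<dots> = (\<Sum>x | (x, y) \<in> X \<and> d x \<noteq> 0. d x)"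
      using Q(1) sub by (intro sum.mono_neutral_right) auto
    finally show "n y = (\<Sum>x | (x, y) \<in> X \<and> d x \<noteq> 0. d x)" .
  next
    fix x assume "x \<notin> Field X"
    then show "d x = 0" using d(1) Q(2) by blast
  qed
  then show ?thesis using that supp by blast
qed

lemma is_moebius_inversion_cong:
  assumes "is_moebius_inversion X m d" "\<And>y. y \<in> Field X \<Longrightarrow> m y = n y"
  shows "is_moebius_inversion X n d"
  using assms unfolding is_moebius_inversion_def by simp

lemma persistence_diagram_eqI:
  assumes "Partial_order P" "is_moebius_inversion (bar_order P) (nullity K M) d"
  shows "persistence_diagram K P M = d"
  unfolding persistence_diagram_def moebius_inversion_def
  using assms moebius_inversion_unique[OF Partial_order_bar_order] by (intro the_equality) blast+

section \<open>Barcodes of rank functions\<close>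

lemma gap_below:
  fixes a b :: real
  assumes "finite F" "a < b"
  obtains c where "a \<le> c" "c < b" "F \<inter> {c..<b} = {}"
proof -
  define m where "m = Max (insert a (F \<inter> {..<b}))"
  have fin: "finite (insert a (F \<inter> {..<b}))" using assms(1) by simp
  have "m < b" "a \<le> m" using assms fin by (auto simp: m_def)
  moreover have "x \<le> m" if "x \<in> F" "x < b" for x using that fin by (auto simp: m_def)
  ultimately show ?thesis by (intro that[of "(m + b) / 2"]) (fastforce)+
qed

text \<open>If \<open>k a b\<close> counts the bars born by time \<open>a\<close> and alive at time \<open>b\<close>, then the alternating sum
  below counts those born in \<open>(p, q]\<close> that die in \<open>(r, s]\<close>. Bars that never die contribute to
  \<open>k\<close> but cancel in the alternating sum. Extending \<open>k\<close> by zero to negative times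
  lets \<open>p < 0\<close> stand for \<open>no lower bound on the birth\<close>, so that bars born at time 0 are no
  exception.\<close>

definition barcode_of :: "(real \<Rightarrow> real \<Rightarrow> int) \<Rightarrow> (real \<times> real) multiset \<Rightarrow> bool" where
  "barcode_of k B \<longleftrightarrow> (\<forall>a b. a < 0 \<longrightarrow> k a b = 0) \<and>
     (\<forall>x \<in># B. 0 \<le> fst x \<and> fst x < snd x) \<and>
     (\<forall>p q r s. p \<le> q \<longrightarrow> q \<le> r \<longrightarrow> r \<le> s \<longrightarrow>
       int (size {#x \<in># B. p < fst x \<and> fst x \<le> q \<and> r < snd x \<and> snd x \<le> s#}) =
       k q r - k p r - k q s + k p s)"

locale rank_function =
  fixes k :: "real \<Rightarrow> real \<Rightarrow> int" and G :: "real set"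
  assumes finite_grid: "finite G" and zero_in_grid: "0 \<in> G"
    and negative: "a < 0 \<Longrightarrow> k a b = 0"
    and frobenius: "p \<le> q \<Longrightarrow> q \<le> r \<Longrightarrow> r \<le> s \<Longrightarrow> k q s + k p r \<le> k q r + k p s"
    and step_left: "0 \<le> a \<Longrightarrow> a \<le> a' \<Longrightarrow> a' \<le> b \<Longrightarrow> G \<inter> {a<..a'} = {} \<Longrightarrow> k a b = k a' b"
    and step_right: "0 \<le> a \<Longrightarrow> a \<le> b \<Longrightarrow> b \<le> b' \<Longrightarrow> G \<inter> {b<..b'} = {} \<Longrightarrow> k a b = k a b'"
begin

definition grid_floor :: "real \<Rightarrow> real" where
  "grid_floor x = Max (G \<inter> {0..x})"

lemma grid_floor:
  assumes "0 \<le> x"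
  shows "grid_floor x \<in> G" "0 \<le> grid_floor x" "grid_floor x \<le> x"
    and "G \<inter> {grid_floor x<..x} = {}"
    and grid_floor_greatest: "g \<in> G \<Longrightarrow> 0 \<le> g \<Longrightarrow> g \<le> x \<Longrightarrow> g \<le> grid_floor x"
proof -
  have fin: "finite (G \<inter> {0..x})" using finite_grid by simp
  have "0 \<in> G \<inter> {0..x}" using zero_in_grid assms by simp
  then have in_G: "grid_floor x \<in> G \<inter> {0..x}"
    unfolding grid_floor_def using Max_in[OF fin] by blast
  then show "grid_floor x \<in> G" "0 \<le> grid_floor x" "grid_floor x \<le> x" by auto
  show *: "g \<le> grid_floor x" if "g \<in> G" "0 \<le> g" "g \<le> x" for g
    unfolding grid_floor_def using that fin by simp
  show "G \<inter> {grid_floor x<..x} = {}" using *  in_G by fastforce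
qed

lemma grid_floor_eq:
  assumes "0 \<le> a" "a \<le> b"
  shows "k (grid_floor a) (grid_floor b) = k a b"
proof -
  have "0 \<le> b" using assms by simp
  have "grid_floor a \<le> grid_floor b"
    using grid_floor[OF assms(1)] grid_floor_greatest[OF \<open>0 \<le> b\<close>] assms(2) by auto
  then have "k (grid_floor a) (grid_floor b) = k (grid_floor a) b"
    using grid_floor[OF assms(1)] grid_floor[OF \<open>0 \<le> b\<close>] by (intro step_right) auto
  also have "\<dots> = k a b"
    using grid_floor[OF assms(1)] assms by (intro step_left) auto
  finally show ?thesis .
qed

text \<open>The Moebius inversion of the nullity may be negative on the diagonal. Off the diagonal, each point
  is isolated from the rest of the finite support by a small rectangle that stays above the diagonal,
  and Frobenius' inequality bounds the sum over that rectangle from below by 0.\<close>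

lemma barcode:
  obtains m B where
    "is_moebius_inversion (bar_order half_line) (\<lambda>(a, b). k a a - k a b) m"
    "\<And>s t. 0 \<le> s \<Longrightarrow> s < t \<Longrightarrow> m (s, t) = int (count B (s, t))"
    "barcode_of k B"
proof -
  let ?X = "bar_order half_line" and ?n = "\<lambda>(a, b). k a a - k a b"
  note X = Partial_order_bar_order[OF Partial_order_half_line]
  have FX: "Field ?X = half_line" by (rule Field_bar_order[OF Partial_order_half_line])
  have X_iff: "((s, t), (a, b)) \<in> ?X \<longleftrightarrow> 0 \<le> s \<and> s \<le> t \<and> a \<le> b \<and> s \<le> a \<and> t \<le> b" for s t a b
    by (auto simp: bar_order_def half_line_def)
  let ?Q = "{(s, t). s \<in> G \<and> t \<in> G \<and> 0 \<le> s \<and> s \<le> t}"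
  have finQ: "finite ?Q"
    by (rule finite_subset[of _ "G \<times> G"]) (use finite_grid in auto)
  have QF: "?Q \<subseteq> Field ?X" unfolding FX by (auto simp: half_line_def)
  have "\<exists>z\<in>?Q. (z, y) \<in> ?X \<and> ?n z = ?n y \<and> (\<forall>x\<in>?Q. (x, y) \<in> ?X \<longrightarrow> (x, z) \<in> ?X)"
    if y: "y \<in> Field ?X" for y
  proof -
    obtain a b where ab: "y = (a, b)" "0 \<le> a" "a \<le> b" "0 \<le> b"
      using y unfolding FX by (cases y) (auto simp: half_line_def)
    note fa = grid_floor[OF ab(2)] and fb = grid_floor[OF ab(4)]
    have le: "grid_floor a \<le> grid_floor b" using fa fb(5)[of "grid_floor a"] ab by auto
    have "?n (grid_floor a, grid_floor b) = ?n y"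
      using grid_floor_eq[OF ab(2,3)] grid_floor_eq[OF ab(2) order_refl] by (simp add: ab(1))
    moreover have "((grid_floor a, grid_floor b), y) \<in> ?X"
      using fa fb le ab by (simp add: X_iff)
    moreover have "\<forall>x\<in>?Q. (x, y) \<in> ?X \<longrightarrow> (x, (grid_floor a, grid_floor b)) \<in> ?X"
      using fa(5) fb(5) le by (auto simp: ab(1) X_iff)
    ultimately show ?thesis using fa fb le by (intro bexI[of _ "(grid_floor a, grid_floor b)"]) auto
  qed
  then obtain m where m: "is_moebius_inversion ?X ?n m" and supp: "{x. m x \<noteq> 0} \<subseteq> ?Q"
    using moebius_inversion_exists[OF X finQ QF, of ?n] by blast
  define S where "S = {x. m x \<noteq> 0}"
  have finS: "finite S" unfolding S_def using finQ supp by (rule finite_subset[rotated])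
  have S: "0 \<le> fst x" "fst x \<le> snd x" if "x \<in> S" for x using that supp by (auto simp: S_def)
  \<comment> \<open>The sums of \<open>m\<close> over lower left quadrants, defined for negative \<open>a\<close> as well.\<close>
  define D where "D a b = (\<Sum>x\<in>S. if fst x \<le> a \<and> snd x \<le> b then m x else 0)" for a b
  have D: "D a b = k a a - k a b" if "a \<le> b" for a b
  proof (cases "0 \<le> a")
    case True
    have "{x. (x, (a, b)) \<in> ?X \<and> m x \<noteq> 0} = {x\<in>S. fst x \<le> a \<and> snd x \<le> b}"
      using S that by (auto simp: S_def X_iff)
    moreover have "(a, b) \<in> Field ?X" unfolding FX using True that by (simp add: half_line_def)
    then have "?n (a, b) = (\<Sum>x | (x, (a, b)) \<in> ?X \<and> m x \<noteq> 0. m x)"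
      using m unfolding is_moebius_inversion_def by blast
    ultimately have "?n (a, b) = (\<Sum>x | x \<in> S \<and> fst x \<le> a \<and> snd x \<le> b. m x)" by simp
    also have "\<dots> = D a b" unfolding D_def by (rule sum.inter_filter[OF finS])
    finally show ?thesis by simp
  next
    case False
    have "(if fst x \<le> a \<and> snd x \<le> b then m x else 0) = 0" if "x \<in> S" for x
      using S(1)[OF that] False by auto
    then have "D a b = 0" unfolding D_def by (intro sum.neutral) blast
    then show ?thesis using False negative by simp
  qed
  have rect: "(\<Sum>x | x \<in> S \<and> p < fst x \<and> fst x \<le> q \<and> r < snd x \<and> snd x \<le> s. m x) =
      k q r - k p r - k q s + k p s" if "p \<le> q" "q \<le> r" "r \<le> s" for p q r s
  proof -
    have "(\<Sum>x | x \<in> S \<and> p < fst x \<and> fst x \<le> q \<and> r < snd x \<and> snd x \<le> s. m x) =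
        (\<Sum>x\<in>S. if p < fst x \<and> fst x \<le> q \<and> r < snd x \<and> snd x \<le> s then m x else 0)"
      by (rule sum.inter_filter[OF finS])
    also have "\<dots> = D q s - D p s - D q r + D p r"
      unfolding D_def sum_subtractf[symmetric] sum.distrib[symmetric]
      by (rule sum.cong[OF refl]) (use that in auto)
    finally show ?thesis using that by (simp add: D)
  qed
  have nonneg: "0 \<le> m (s, t)" if st: "s < t" for s t
  proof -
    obtain p where p: "s - 1 \<le> p" "p < s" "fst ` S \<inter> {p..<s} = {}"
      by (rule gap_below[of "fst ` S" "s - 1" s]) (use finS in simp_all)
    obtain r where r: "s \<le> r" "r < t" "snd ` S \<inter> {r..<t} = {}"
      by (rule gap_below[OF finite_imageI[OF finS] st])
    have "x = (s, t)" if "x \<in> S" "p < fst x" "fst x \<le> s" "r < snd x" "snd x \<le> t" for x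
    proof -
      have "fst x \<notin> {p..<s}" "snd x \<notin> {r..<t}" using p(3) r(3) that(1) by blast+
      then show ?thesis using that by (cases x) auto
    qed
    then have sub: "{x. x \<in> S \<and> p < fst x \<and> fst x \<le> s \<and> r < snd x \<and> snd x \<le> t} \<subseteq> {(s, t)}"
      by blast
    have "(\<Sum>x | x \<in> S \<and> p < fst x \<and> fst x \<le> s \<and> r < snd x \<and> snd x \<le> t. m x) = sum m {(s, t)}"
      using p(2) r(2) by (intro sum.mono_neutral_left sub) (auto simp: S_def)
    then have "m (s, t) = (\<Sum>x | x \<in> S \<and> p < fst x \<and> fst x \<le> s \<and> r < snd x \<and> snd x \<le> t. m x)"
      by simp
    also have "\<dots> = k s r - k p r - k s t + k p t" using p r by (intro rect) auto
    also have "\<dots> \<ge> 0" using frobenius[of p s r t] p r by simp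
    finally show ?thesis .
  qed
  define B where "B = Abs_multiset (\<lambda>x. if fst x < snd x then nat (m x) else 0)"
  have count: "count B x = (if fst x < snd x then nat (m x) else 0)" for x
    unfolding B_def
    by (subst count_Abs_multiset) (rule finite_subset[OF _ finS], auto simp: S_def split: if_splits)
  have set: "set_mset B \<subseteq> S" by (auto simp: S_def count split: if_splits simp flip: count_greater_zero_iff)
  show ?thesis
  proof (rule that[OF m])
    show "m (s, t) = int (count B (s, t))" if "0 \<le> s" "s < t" for s t
      using nonneg[OF that(2)] that(2) by (simp add: count)
    have "0 \<le> fst x \<and> fst x < snd x" if "x \<in># B" for x
    proof -
      have "x \<in> S" using that set by blast
      moreover have "fst x < snd x" using that count[of x]
        by (auto split: if_splits simp flip: count_greater_zero_iff)
      ultimately show ?thesis using S(1) by blast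
    qed
    moreover have "int (size {#x \<in># B. p < fst x \<and> fst x \<le> q \<and> r < snd x \<and> snd x \<le> s#}) =
      k q r - k p r - k q s + k p s" if le: "p \<le> q" "q \<le> r" "r \<le> s" for p q r s
    proof -
      let ?R = "\<lambda>x. p < fst x \<and> fst x \<le> q \<and> r < snd x \<and> snd x \<le> s"
      have "size {#x \<in># B. ?R x#} = (\<Sum>x | x \<in> S \<and> ?R x. count B x)"
        unfolding size_multiset_overloaded_eq
        using finS set by (intro sum.mono_neutral_cong_left) (auto simp: not_in_iff)
      then have "int (size {#x \<in># B. ?R x#}) = (\<Sum>x | x \<in> S \<and> ?R x. int (count B x))"
        by simp
      also have "\<dots> = (\<Sum>x | x \<in> S \<and> ?R x. m x)"
        using nonneg le by (intro sum.cong) (auto simp: count)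
      finally show ?thesis using rect[OF le] by simp
    qed
    ultimately show "barcode_of k B" using negative unfolding barcode_of_def by blast
  qed
qed

end

lemma barcode_of_corner:
  assumes "barcode_of k B" "q \<le> r" "r \<le> s"
  shows "int (size {#x \<in># B. fst x \<le> q \<and> r < snd x \<and> snd x \<le> s#}) = k q r - k q s"
proof -
  let ?p = "min q (- 1)"
  have "{#x \<in># B. fst x \<le> q \<and> r < snd x \<and> snd x \<le> s#} =
      {#x \<in># B. ?p < fst x \<and> fst x \<le> q \<and> r < snd x \<and> snd x \<le> s#}"
    using assms(1) unfolding barcode_of_def by (intro filter_mset_cong refl) fastforce
  moreover have "?p \<le> q" "k ?p r = 0" "k ?p s = 0" using assms(1) by (auto simp: barcode_of_def)
  ultimately show ?thesis using assms unfolding barcode_of_def by simp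
qed

section \<open>Matching barcodes with one common endpoint\<close>

text \<open>Bars that share an endpoint are recorded as pairs of a key (the common endpoint) and a value that
  orders them.\<close>

definition above :: "('k \<times> real) multiset \<Rightarrow> 'k \<Rightarrow> real \<Rightarrow> nat" where
  "above A k x = size {#y \<in># A. fst y = k \<and> x < snd y#}"

lemma above_add_mset:
  "above (add_mset y A) k x = above A k x + (if fst y = k \<and> x < snd y then 1 else 0)"
  by (simp add: above_def)

lemma above_pos_iff: "0 < above A k x \<longleftrightarrow> (\<exists>y. y \<in># A \<and> fst y = k \<and> x < snd y)"
proof -
  have "0 < above A k x \<longleftrightarrow> {#y \<in># A. fst y = k \<and> x < snd y#} \<noteq> {#}"
    unfolding above_def by (simp only: nonempty_has_size)
  then show ?thesis by (auto simp: filter_mset_eq_conv multiset_eq_iff)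
qed

lemma greatest_of_key:
  fixes A :: "('k \<times> real) multiset"
  assumes "z \<in># A" "fst z = k"
  obtains a where "(k, a) \<in># A" "\<And>y. y \<in># A \<Longrightarrow> fst y = k \<Longrightarrow> snd y \<le> a"
proof -
  let ?S = "snd ` {y \<in> set_mset A. fst y = k}"
  have fin: "finite ?S" by simp
  have ne: "?S \<noteq> {}" using assms by blast
  have "Max ?S \<in> ?S" by (rule Max_in[OF fin ne])
  then have "(k, Max ?S) \<in># A" by (metis (mono_tags, lifting) imageE mem_Collect_eq prod.collapse)
  moreover have "snd y \<le> Max ?S" if "y \<in># A" "fst y = k" for y
    using that by (intro Max_ge[OF fin]) blast
  ultimately show ?thesis using that by blast
qed

text \<open>For each key, the \<open>i\<close>-th largest value in \<open>B\<close> is matched with the \<open>i\<close>-th largest in \<open>A\<close>. The proof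
  matches the two largest values of some key and removes them: the counts that change drop by
  one on both sides, or else the smaller count is already zero. The counts are compared only above
  \<open>lo\<close>, so values of \<open>A\<close> up to \<open>lo + c\<close> may have no partner.\<close>

lemma keyed_matching:
  fixes A B :: "('k \<times> real) multiset"
  assumes "\<And>y. y \<in># B \<Longrightarrow> lo (fst y) < snd y"
    and "\<And>k x. lo k < x \<Longrightarrow> above B k x \<le> above A k x"
    and "\<And>k x. lo k < x \<Longrightarrow> above A k (x + c) \<le> above B k x"
  shows "\<exists>A' A''. A = A' + A'' \<and>
    rel_mset (\<lambda>a b. fst a = fst b \<and> snd b \<le> snd a \<and> snd a \<le> snd b + c) A' B \<and>
    (\<forall>a\<in>#A''. snd a \<le> lo (fst a) + c)"
  using assms
proof (induction "size B" arbitrary: A B)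
  case 0
  then have B: "B = {#}" by simp
  have "snd a \<le> lo (fst a) + c" if "a \<in># A" for a
  proof (rule ccontr)
    assume "\<not> snd a \<le> lo (fst a) + c"
    then obtain x where x: "lo (fst a) < x" "x + c < snd a"
      using dense[of "lo (fst a)" "snd a - c"] by auto
    have "0 < above A (fst a) (x + c)"
      unfolding above_pos_iff using that x(2) by blast
    moreover have "above B (fst a) x = 0" by (simp add: B above_def)
    ultimately show False using "0.prems"(3)[OF x(1)] by linarith
  qed
  then show ?case using B by (intro exI[of _ "{#}"] exI[of _ A]) (simp add: rel_mset_Zero)
next
  case (Suc n)
  obtain z where z: "z \<in># B" using Suc.hyps(2) by (metis nat.simps(3) size_eq_0_iff_empty multiset_nonemptyE)
  define k where "k = fst z"
  obtain b where b: "(k, b) \<in># B" and b_max: "\<And>y. y \<in># B \<Longrightarrow> fst y = k \<Longrightarrow> snd y \<le> b"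
    by (rule greatest_of_key[OF z k_def[symmetric]]) blast
  have lo_b: "lo k < b" using Suc.prems(1)[OF b] by simp
  have B_pos: "0 < above B k x" if "x < b" for x using b that by (force simp: above_pos_iff)
  have A_pos: "0 < above A k x" if "lo k < x" "x < b" for x
    using B_pos[OF that(2)] Suc.prems(2)[OF that(1)] by linarith
  obtain x where "lo k < x" "x < b" using dense[OF lo_b] by blast
  then have "0 < above A k x" by (rule A_pos)
  then have "\<exists>z'. z' \<in># A \<and> fst z' = k" unfolding above_pos_iff by blast
  then obtain z' where z': "z' \<in># A" "fst z' = k" by blast
  obtain a where a: "(k, a) \<in># A" and a_max: "\<And>y. y \<in># A \<Longrightarrow> fst y = k \<Longrightarrow> snd y \<le> a"
    by (rule greatest_of_key[OF z']) blast
  have above_a: "x < a" if "0 < above A k x" for x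
    using that a_max by (force simp: above_pos_iff)
  have above_b: "x < b" if "0 < above B k x" for x
    using that b_max by (force simp: above_pos_iff)
  have "b \<le> a"
  proof (rule ccontr)
    assume "\<not> b \<le> a"
    then obtain x where "max a (lo k) < x" "x < b" using dense[of "max a (lo k)" b] lo_b by auto
    then show False using above_a[OF A_pos[of x]] by simp
  qed
  have "a \<le> b + c"
  proof (rule ccontr)
    assume "\<not> a \<le> b + c"
    then have "lo k < b" "b + c < a" using lo_b by auto
    then have "0 < above A k (b + c)" using a by (force simp: above_pos_iff)
    then show False using Suc.prems(3)[OF lo_b] above_b[of b] by linarith
  qed
  obtain A1 B1 where A1: "A = add_mset (k, a) A1" and B1: "B = add_mset (k, b) B1"
    using a b by (meson multi_member_split)
  have "\<exists>A' A''. A1 = A' + A'' \<and>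
    rel_mset (\<lambda>a b. fst a = fst b \<and> snd b \<le> snd a \<and> snd a \<le> snd b + c) A' B1 \<and>
    (\<forall>a\<in>#A''. snd a \<le> lo (fst a) + c)"
  proof (rule Suc.hyps(1))
    show "n = size B1" using Suc.hyps(2) B1 by simp
    show "lo (fst y) < snd y" if "y \<in># B1" for y using Suc.prems(1) that B1 by simp
    show "above B1 k' x \<le> above A1 k' x" if "lo k' < x" for k' x
    proof (cases "k' = k \<and> b \<le> x")
      case True
      then have "\<not> 0 < above B k x" using above_b by force
      then show ?thesis using True by (simp add: B1 above_add_mset)
    next
      case False
      then show ?thesis using Suc.prems(2)[OF that] \<open>b \<le> a\<close>
        by (auto simp: A1 B1 above_add_mset split: if_splits)
    qed
    show "above A1 k' (x + c) \<le> above B1 k' x" if "lo k' < x" for k' x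
    proof (cases "k' = k \<and> a \<le> x + c")
      case True
      then have "\<not> 0 < above A k (x + c)" using above_a by force
      then show ?thesis using True by (simp add: A1 above_add_mset)
    next
      case False
      then show ?thesis using Suc.prems(3)[OF that] \<open>a \<le> b + c\<close>
        by (auto simp: A1 B1 above_add_mset split: if_splits)
    qed
  qed
  then obtain A' A'' where A': "A1 = A' + A''"
    "rel_mset (\<lambda>a b. fst a = fst b \<and> snd b \<le> snd a \<and> snd a \<le> snd b + c) A' B1"
    "\<forall>a\<in>#A''. snd a \<le> lo (fst a) + c" by blast
  have "rel_mset (\<lambda>a b. fst a = fst b \<and> snd b \<le> snd a \<and> snd a \<le> snd b + c)
      (add_mset (k, a) A') B"
    unfolding B1 using A'(2) \<open>b \<le> a\<close> \<open>a \<le> b + c\<close> by (intro rel_mset_Plus) auto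
  then show ?case using A' A1 by (intro exI[of _ "add_mset (k, a) A'"] exI[of _ A'']) simp
qed

text \<open>The case where \<open>l\<close> is a quotient of \<open>k\<close> through which the shift by \<open>c\<close> factors: births agree, and
  deaths move down by at most \<open>c\<close>. The hypotheses compare the numbers of bars born in \<open>(p, q]\<close> and
  alive at \<open>r\<close>.\<close>

lemma match_births:
  assumes A: "barcode_of k A" and B: "barcode_of l B" and "0 \<le> c"
    and le: "\<And>p q r. p \<le> q \<Longrightarrow> q \<le> r \<Longrightarrow> l q r - l p r \<le> k q r - k p r"
    and ge: "\<And>p q r. p \<le> q \<Longrightarrow> q \<le> r \<Longrightarrow> k q (r + c) - k p (r + c) \<le> l q r - l p r"
  shows "\<exists>A' A''. A = A' + A'' \<and>
    rel_mset (\<lambda>a b. fst a = fst b \<and> snd b \<le> snd a \<and> snd a \<le> snd b + c) A' B \<and>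
    (\<forall>a\<in>#A''. snd a \<le> fst a + c)"
proof (rule keyed_matching)
  show "fst y < snd y" if "y \<in># B" for y using B that by (auto simp: barcode_of_def)
  have "above B s x \<le> above A s x \<and> above A s (x + c) \<le> above B s x" if "s < x" for s x
  proof -
    let ?F = "fst ` set_mset A \<union> fst ` set_mset B"
    let ?D = "snd ` set_mset A \<union> snd ` set_mset B"
    obtain p where p: "s - 1 \<le> p" "p < s" "?F \<inter> {p..<s} = {}"
      by (rule gap_below[of ?F "s - 1" s]) simp_all
    \<comment> \<open>By time \<open>S\<close> all the finite bars are dead.\<close>
    define S where "S = Max (insert (x + c) ?D)"
    have S: "x + c \<le> S" and DS: "\<And>d. d \<in> ?D \<Longrightarrow> d \<le> S" by (auto simp: S_def)
    have column: "int (above C s y) = h s y - h p y - h s S + h p S"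
      if C: "barcode_of h C" "C = A \<or> C = B" and y: "s \<le> y" "y \<le> S" for h C y
    proof -
      have "fst z = s \<and> y < snd z \<longleftrightarrow> p < fst z \<and> fst z \<le> s \<and> y < snd z \<and> snd z \<le> S"
        if z: "z \<in># C" for z
      proof -
        have "fst z \<in> ?F" "snd z \<in> ?D" using z C(2) by auto
        then have "fst z \<notin> {p..<s}" "snd z \<le> S" using p(3) DS by blast+
        then show ?thesis using p(2) by auto
      qed
      then have "{#z \<in># C. fst z = s \<and> y < snd z#} =
          {#z \<in># C. p < fst z \<and> fst z \<le> s \<and> y < snd z \<and> snd z \<le> S#}"
        by (intro filter_mset_cong refl)
      then show ?thesis using C(1) p y unfolding above_def barcode_of_def by simp
    qed
    have "k s S - k p S = k s (S + c) - k p (S + c)"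
    proof -
      have empty: "{#z \<in># A. p < fst z \<and> fst z \<le> s \<and> S < snd z \<and> snd z \<le> S + c#} = {#}"
        using DS by force
      have "int (size {#z \<in># A. p < fst z \<and> fst z \<le> s \<and> S < snd z \<and> snd z \<le> S + c#}) =
          k s S - k p S - k s (S + c) + k p (S + c)"
        using A p S that \<open>0 \<le> c\<close> unfolding barcode_of_def by simp
      then show ?thesis unfolding empty by simp
    qed
    \<comment> \<open>The two sides count the bars born at \<open>s\<close> that never die.\<close>
    then have top: "k s S - k p S = l s S - l p S"
      using le[of p s S] ge[of p s S] p S that \<open>0 \<le> c\<close> by simp
    have "int (above B s x) \<le> int (above A s x)"
      using column[OF A, of x] column[OF B, of x] le[of p s x] top p S that \<open>0 \<le> c\<close> by simp
    moreover have "int (above A s (x + c)) \<le> int (above B s x)"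
      using column[OF A, of "x + c"] column[OF B, of x] ge[of p s x] top p S that \<open>0 \<le> c\<close> by simp
    ultimately show ?thesis by simp
  qed
  then show "above B s x \<le> above A s x" "above A s (x + c) \<le> above B s x" if "s < x" for s x
    using that by blast+
qed

text \<open>The case where \<open>l\<close> at time \<open>x\<close> is a subspace of \<open>k\<close> at time \<open>x + e\<close> that contains the image of
  \<open>k\<close> at time \<open>x - e\<close>. The hypotheses compare the
  numbers of bars born by time \<open>x\<close> that die in \<open>(d', d]\<close>.\<close>

lemma match_deaths:
  assumes A: "barcode_of k A" and B: "barcode_of l B" and "0 \<le> e"
    and le: "\<And>x d' d. x \<le> d' \<Longrightarrow> d' \<le> d \<Longrightarrow>
      l x d' - l x d \<le> k (x + e) (d' + e) - k (x + e) (d + e)"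
    and ge: "\<And>x d' d. x + e \<le> d' \<Longrightarrow> d' \<le> d \<Longrightarrow>
      k x (d' + e) - k x (d + e) \<le> l (x + e) d' - l (x + e) d"
  shows "\<exists>A' A''. A = A' + A'' \<and>
    rel_mset (\<lambda>a b. snd a = snd b + e \<and> fst b - e \<le> fst a \<and> fst a \<le> fst b + e) A' B \<and>
    (\<forall>a\<in>#A''. snd a \<le> fst a + 2 * e)"
proof -
  \<comment> \<open>Deaths become keys and births, negated to reverse their order, become values. The shifts in
    \<open>f\<close> translate deaths to the time scale of \<open>l\<close> and turn the two-sided bound \<open>e\<close> on births into
    the one-sided bound \<open>2 * e\<close>.\<close>
  define f where "f z = (snd z - e, e - fst z)" for z :: "real \<times> real"
  define g where "g z = (snd z, - fst z)" for z :: "real \<times> real"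
  have above_f: "above (image_mset f A) t x = size {#z \<in># A. snd z = t + e \<and> fst z < e - x#}" for t x
  proof -
    have "{#y \<in># image_mset f A. fst y = t \<and> x < snd y#} =
        image_mset f {#z \<in># A. snd z = t + e \<and> fst z < e - x#}"
      unfolding filter_mset_image_mset
      by (intro arg_cong[of _ _ "image_mset f"] filter_mset_cong refl) (auto simp: f_def)
    then show ?thesis by (simp add: above_def)
  qed
  have above_g: "above (image_mset g B) t x = size {#z \<in># B. snd z = t \<and> fst z < - x#}" for t x
  proof -
    have "{#y \<in># image_mset g B. fst y = t \<and> x < snd y#} =
        image_mset g {#z \<in># B. snd z = t \<and> fst z < - x#}"
      unfolding filter_mset_image_mset
      by (intro arg_cong[of _ _ "image_mset g"] filter_mset_cong refl) (auto simp: g_def)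
    then show ?thesis by (simp add: above_def)
  qed
  have counts: "above (image_mset g B) t x \<le> above (image_mset f A) t x \<and>
      above (image_mset f A) t (x + 2 * e) \<le> above (image_mset g B) t x" if "- t < x" for t x
  proof -
    define u where "u = - x"
    have "u < t" using that by (simp add: u_def)
    let ?F = "fst ` set_mset B \<union> (\<lambda>z. fst z - e) ` set_mset A \<union> (\<lambda>z. fst z + e) ` set_mset A"
    let ?D = "snd ` set_mset B \<union> (\<lambda>z. snd z - e) ` set_mset A"
    \<comment> \<open>Moving the bounds slightly down to \<open>v\<close> and \<open>r\<close> replaces the strict inequality for births, and
      the equation for deaths, by half-open intervals.\<close>
    obtain v where v: "u - 1 \<le> v" "v < u" "?F \<inter> {v..<u} = {}"
      by (rule gap_below[of ?F "u - 1" u]) simp_all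
    have "finite ?D" by simp
    obtain r where r: "u \<le> r" "r < t" "?D \<inter> {r..<t} = {}"
      by (rule gap_below[OF \<open>finite ?D\<close> \<open>u < t\<close>])
    have B_count: "int (size {#z \<in># B. snd z = t \<and> fst z < u#}) = l v r - l v t"
    proof -
      have "snd z = t \<and> fst z < u \<longleftrightarrow> fst z \<le> v \<and> r < snd z \<and> snd z \<le> t" if z: "z \<in># B" for z
      proof -
        have "fst z \<in> ?F" "snd z \<in> ?D" using z by auto
        then have "fst z \<notin> {v..<u}" "snd z \<notin> {r..<t}" using v(3) r(3) by blast+
        then show ?thesis using v(2) r(2) by auto
      qed
      then have "{#z \<in># B. snd z = t \<and> fst z < u#} =
          {#z \<in># B. fst z \<le> v \<and> r < snd z \<and> snd z \<le> t#}"
        by (intro filter_mset_cong refl)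
      then show ?thesis using barcode_of_corner[OF B, of v r t] v r by simp
    qed
    have A_count: "int (size {#z \<in># A. snd z = t + e \<and> fst z < u + e'#}) =
        k (v + e') (r + e) - k (v + e') (t + e)" if e': "e' = e \<or> e' = - e" for e'
    proof -
      have "snd z = t + e \<and> fst z < u + e' \<longleftrightarrow>
          fst z \<le> v + e' \<and> r + e < snd z \<and> snd z \<le> t + e" if z: "z \<in># A" for z
      proof -
        have "fst z - e' \<in> ?F" "snd z - e \<in> ?D" using z e' by auto
        then have "fst z - e' \<notin> {v..<u}" "snd z - e \<notin> {r..<t}" using v(3) r(3) by blast+
        then show ?thesis using v(2) r(2) by auto
      qed
      then have "{#z \<in># A. snd z = t + e \<and> fst z < u + e'#} =
          {#z \<in># A. fst z \<le> v + e' \<and> r + e < snd z \<and> snd z \<le> t + e#}"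
        by (intro filter_mset_cong refl)
      moreover have "v + e' \<le> r + e" "r + e \<le> t + e" using v r e' \<open>0 \<le> e\<close> by auto
      ultimately show ?thesis using barcode_of_corner[OF A, of "v + e'" "r + e" "t + e"] by simp
    qed
    have "l v r - l v t \<le> k (v + e) (r + e) - k (v + e) (t + e)" using v r by (intro le) auto
    then have "size {#z \<in># B. snd z = t \<and> fst z < u#} \<le>
        size {#z \<in># A. snd z = t + e \<and> fst z < u + e#}"
      using B_count A_count[of e] by simp
    moreover have "k (v - e) (r + e) - k (v - e) (t + e) \<le> l v r - l v t"
      using ge[of "v - e" r t] v r by simp
    then have "size {#z \<in># A. snd z = t + e \<and> fst z < u - e#} \<le>
        size {#z \<in># B. snd z = t \<and> fst z < u#}"
      using B_count A_count[of "- e"] by simp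
    moreover have "e - x = u + e" "e - (x + 2 * e) = u - e" "- x = u" by (simp_all add: u_def)
    ultimately show ?thesis unfolding above_f above_g by metis
  qed
  have "- fst y < snd y" if "y \<in># image_mset g B" for y
    using B that by (auto simp: barcode_of_def g_def)
  then have "\<exists>A' A''. image_mset f A = A' + A'' \<and>
      rel_mset (\<lambda>a b. fst a = fst b \<and> snd b \<le> snd a \<and> snd a \<le> snd b + 2 * e) A' (image_mset g B) \<and>
      (\<forall>a\<in>#A''. snd a \<le> - fst a + 2 * e)"
    using counts by (intro keyed_matching) blast+
  then obtain F F' where F: "image_mset f A = F + F'"
    "rel_mset (\<lambda>a b. fst a = fst b \<and> snd b \<le> snd a \<and> snd a \<le> snd b + 2 * e) F (image_mset g B)"
    "\<forall>a\<in>#F'. snd a \<le> - fst a + 2 * e" by blast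
  obtain A' A'' where A': "A = A' + A''" "F = image_mset f A'" "F' = image_mset f A''"
    using image_mset_eq_plusD[OF F(1)] by blast
  have "rel_mset (\<lambda>a b. fst (f a) = fst (g b) \<and> snd (g b) \<le> snd (f a) \<and>
      snd (f a) \<le> snd (g b) + 2 * e) A' B"
    using F(2) unfolding A'(2) by (simp add: multiset.rel_map)
  then have "rel_mset (\<lambda>a b. snd a = snd b + e \<and> fst b - e \<le> fst a \<and> fst a \<le> fst b + e) A' B"
    by (rule multiset.rel_mono_strong) (auto simp: f_def g_def)
  moreover have "\<forall>a\<in>#A''. snd a \<le> fst a + 2 * e" using F(3) unfolding A'(3) by (auto simp: f_def)
  ultimately show ?thesis using A'(1) by blast
qed

section \<open>Matchings from multisets of pairs of intervals\<close>

text \<open>A multiset of pairs of intervals is a matching over a disjoint union of two-element chains, one for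
  each pair; \<open>False\<close> and \<open>True\<close> are the lower and the upper element of a chain.\<close>

lemma bottleneck_distance_le:
  fixes Z :: "((real \<times> real) \<times> (real \<times> real)) multiset"
  assumes Z: "\<And>I J. (I, J) \<in># Z \<Longrightarrow> I \<in> half_line \<and> J \<in> half_line \<and> dist_bar I J \<le> \<epsilon>"
    and w0: "\<And>s t. 0 \<le> s \<Longrightarrow> s < t \<Longrightarrow> w0 (s, t) = int (count (image_mset fst Z) (s, t))"
    and w1: "\<And>s t. 0 \<le> s \<Longrightarrow> s < t \<Longrightarrow> w1 (s, t) = int (count (image_mset snd Z) (s, t))"
    and "0 \<le> \<epsilon>"
  shows "bottleneck_distance w0 w1 \<le> ereal \<epsilon>"
proof -
  obtain zs where zs: "mset zs = Z" using ex_mset by blast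
  let ?N = "{..<length zs}"
  define R :: "(nat \<times> bool) rel" where
    "R = {((i, b), (j, b')). i < length zs \<and> i = j \<and> (b \<longrightarrow> b')}"
  define \<nu> :: "(nat \<times> bool) \<times> (nat \<times> bool) \<Rightarrow> int" where
    "\<nu> J = (if \<not> snd (fst J) \<and> snd (snd J) then 1 else 0)" for J
  define f where "f pr x = (if snd x then snd else fst) (pr (zs ! fst x))"
    for pr :: "(real \<times> real) \<times> (real \<times> real) \<Rightarrow> real \<times> real" and x :: "nat \<times> bool"
  define e :: "nat \<Rightarrow> (nat \<times> bool) \<times> (nat \<times> bool)" where "e i = ((i, False), (i, True))" for i
  have inj_e: "inj_on e S" for S by (auto simp: e_def inj_on_def)
  have supp: "{J \<in> R. \<nu> J \<noteq> 0} = e ` ?N" by (auto simp: R_def \<nu>_def e_def)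
  have f_e: "map_prod (f pr) (f pr) (e i) = pr (zs ! i)" for pr i by (simp add: f_def e_def)
  have \<nu>_e: "\<nu> (e i) = 1" for i by (simp add: \<nu>_def e_def)
  have in_Z: "zs ! i \<in># Z" if "i < length zs" for i using that zs by force
  have R: "Partial_order R" by (rule Partial_orderI) (auto simp: R_def)
  have ord: "order_preserving R half_line (f fst)" "order_preserving R half_line (f snd)"
  proof -
    have Zi: "fst (zs ! i) \<in> half_line \<and> snd (zs ! i) \<in> half_line" if "i < length zs" for i
      using Z[of "fst (zs ! i)" "snd (zs ! i)"] in_Z[OF that] by simp
    have "(f pr (i, b), f pr (i, b')) \<in> half_line"
      if "pr (zs ! i) \<in> half_line" "b \<longrightarrow> b'" for pr i b b'
      using that by (cases "pr (zs ! i)") (auto simp: f_def half_line_def)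
    then show "order_preserving R half_line (f fst)" "order_preserving R half_line (f snd)"
      using Zi by (auto simp: order_preserving_def R_def)
  qed
  have sum: "(\<Sum>J | J \<in> R \<and> \<nu> J \<noteq> 0 \<and> map_prod (f pr) (f pr) J = I. \<nu> J) =
      int (count (image_mset pr Z) I)" for pr I
  proof -
    have "{J. J \<in> R \<and> \<nu> J \<noteq> 0 \<and> map_prod (f pr) (f pr) J = I} = e ` {i. i < length zs \<and> pr (zs ! i) = I}"
    proof -
      have "{J. J \<in> R \<and> \<nu> J \<noteq> 0 \<and> map_prod (f pr) (f pr) J = I} =
          {J \<in> e ` ?N. map_prod (f pr) (f pr) J = I}"
        unfolding supp[symmetric] by blast
      also have "\<dots> = e ` {i. i < length zs \<and> pr (zs ! i) = I}"
        by (auto simp del: map_prod_simp simp: f_e)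
      finally show ?thesis .
    qed
    then have "(\<Sum>J | J \<in> R \<and> \<nu> J \<noteq> 0 \<and> map_prod (f pr) (f pr) J = I. \<nu> J) =
        int (card {i. i < length zs \<and> pr (zs ! i) = I})"
      by (simp add: sum.reindex[OF inj_e] \<nu>_e)
    also have "card {i. i < length zs \<and> pr (zs ! i) = I} = length (filter (\<lambda>z. pr z = I) zs)"
      by (simp add: length_filter_conv_card)
    also have "\<dots> = count (image_mset pr Z) I"
      unfolding zs[symmetric] by (induction zs) auto
    finally show ?thesis .
  qed
  have "is_matching half_line w0 w1 R \<nu> (f fst) (f snd)"
    unfolding is_matching_def sum
    using R ord w0 w1 supp by (auto simp: half_line_def \<nu>_def)
  then have "bottleneck_distance w0 w1 \<le> ereal (matching_cost R \<nu> (f fst) (f snd))"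
    by (rule matching_cost_on_nat)
  also have "matching_cost R \<nu> (f fst) (f snd) \<le> \<epsilon>"
    unfolding matching_cost_def supp using \<open>0 \<le> \<epsilon>\<close> Z in_Z
    by (auto simp: f_e intro!: Max.boundedI)
  finally show ?thesis by simp
qed

text \<open>The barcode \<open>Y\<close> of \<open>l\<close> mediates: each of its bars is matched with a bar of \<open>X0\<close> that has the same
  birth and with a bar of \<open>X1\<close> whose death is later by exactly \<open>e\<close>. A death in \<open>X0\<close> exceeds the
  matched one in \<open>Y\<close> by an amount between 0 and \<open>2 * e\<close>, and so differs from the matched one in
  \<open>X1\<close> by at most \<open>e\<close>.\<close>

lemma bottleneck_le_of_rank_functions:
  assumes X: "barcode_of k0 X0" "barcode_of k1 X1" and Y: "barcode_of l Y" and "0 \<le> e"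
    and births_le: "\<And>p q r. p \<le> q \<Longrightarrow> q \<le> r \<Longrightarrow> l q r - l p r \<le> k0 q r - k0 p r"
    and births_ge: "\<And>p q r. p \<le> q \<Longrightarrow> q \<le> r \<Longrightarrow>
      k0 q (r + 2 * e) - k0 p (r + 2 * e) \<le> l q r - l p r"
    and deaths_le: "\<And>x d' d. x \<le> d' \<Longrightarrow> d' \<le> d \<Longrightarrow>
      l x d' - l x d \<le> k1 (x + e) (d' + e) - k1 (x + e) (d + e)"
    and deaths_ge: "\<And>x d' d. x + e \<le> d' \<Longrightarrow> d' \<le> d \<Longrightarrow>
      k1 x (d' + e) - k1 x (d + e) \<le> l (x + e) d' - l (x + e) d"
    and w0: "\<And>s t. 0 \<le> s \<Longrightarrow> s < t \<Longrightarrow> w0 (s, t) = int (count X0 (s, t))"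
    and w1: "\<And>s t. 0 \<le> s \<Longrightarrow> s < t \<Longrightarrow> w1 (s, t) = int (count X1 (s, t))"
  shows "bottleneck_distance w0 w1 \<le> ereal e"
proof -
  have "0 \<le> 2 * e" using \<open>0 \<le> e\<close> by simp
  obtain A A' where A: "X0 = A + A'"
    "rel_mset (\<lambda>a b. fst a = fst b \<and> snd b \<le> snd a \<and> snd a \<le> snd b + 2 * e) A Y"
    "\<forall>a\<in>#A'. snd a \<le> fst a + 2 * e"
    using match_births[OF X(1) Y \<open>0 \<le> 2 * e\<close> births_le births_ge] by blast
  obtain C C' where C: "X1 = C + C'"
    "rel_mset (\<lambda>a b. snd a = snd b + e \<and> fst b - e \<le> fst a \<and> fst a \<le> fst b + e) C Y"
    "\<forall>a\<in>#C'. snd a \<le> fst a + 2 * e"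
    using match_deaths[OF X(2) Y \<open>0 \<le> e\<close> deaths_le deaths_ge] by blast
  have "rel_mset (\<lambda>I J. dist_bar I J \<le> e) A C"
  proof -
    have "rel_mset ((\<lambda>a b. fst a = fst b \<and> snd b \<le> snd a \<and> snd a \<le> snd b + 2 * e) OO
        (\<lambda>a b. snd a = snd b + e \<and> fst b - e \<le> fst a \<and> fst a \<le> fst b + e)\<inverse>\<inverse>) A C"
      unfolding multiset.rel_compp multiset.rel_conversep using A(2) C(2) by blast
    then show ?thesis
      by (rule multiset.rel_mono_strong) (auto simp: dist_bar_def)
  qed
  then obtain Z0 where Z0: "set_mset Z0 \<subseteq> {(I, J). dist_bar I J \<le> e}"
    "image_mset fst Z0 = A" "image_mset snd Z0 = C"
    unfolding multiset.in_rel by blast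
  define mid :: "real \<times> real \<Rightarrow> real \<times> real" where
    "mid I = ((fst I + snd I) / 2, (fst I + snd I) / 2)" for I
  define Z where "Z = Z0 + image_mset (\<lambda>I. (I, mid I)) A' + image_mset (\<lambda>J. (mid J, J)) C'"
  have fst_Z: "image_mset fst Z = X0 + image_mset mid C'"
    by (simp add: Z_def Z0(2) A(1) image_mset.compositionality comp_def)
  have snd_Z: "image_mset snd Z = X1 + image_mset mid A'"
    by (simp add: Z_def Z0(3) C(1) image_mset.compositionality comp_def)
  have mid_count: "count (image_mset mid M) (s, t) = 0" if "s < t" for M s t
  proof -
    have "(s, t) \<notin># image_mset mid M" using that by (auto simp: mid_def)
    then show ?thesis by (simp only: not_in_iff)
  qed
  have X0_half: "I \<in> half_line \<and> mid I \<in> half_line" if "I \<in># X0" for I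
    using that X(1) by (cases I) (auto simp: barcode_of_def half_line_def mid_def)
  have X1_half: "I \<in> half_line \<and> mid I \<in> half_line" if "I \<in># X1" for I
    using that X(2) by (cases I) (auto simp: barcode_of_def half_line_def mid_def)
  show ?thesis
  proof (rule bottleneck_distance_le[of Z])
    fix I J assume IJ: "(I, J) \<in># Z"
    have I: "I \<in># X0 + image_mset mid C'" unfolding fst_Z[symmetric] using IJ by force
    have J: "J \<in># X1 + image_mset mid A'" unfolding snd_Z[symmetric] using IJ by force
    have "I \<in># X0 \<or> I \<in> mid ` set_mset C'" using I by simp
    then have "I \<in> half_line" using X0_half X1_half C(1) by (metis imageE union_iff)
    moreover have "J \<in># X1 \<or> J \<in> mid ` set_mset A'" using J by simp
    then have "J \<in> half_line" using X0_half X1_half A(1) by (metis imageE union_iff)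
    moreover have "dist_bar I J \<le> e"
    proof -
      consider "(I, J) \<in># Z0" | "I \<in># A'" "J = mid I" | "J \<in># C'" "I = mid J"
        using IJ by (auto simp: Z_def)
      then show ?thesis
      proof cases
        case 1
        then show ?thesis using Z0(1) by auto
      next
        case 2
        moreover have "fst I < snd I" using 2(1) A(1) X(1) by (auto simp: barcode_of_def)
        moreover have "snd I \<le> fst I + 2 * e" using 2(1) A(3) by blast
        ultimately show ?thesis by (auto simp: dist_bar_def mid_def field_simps)
      next
        case 3
        moreover have "fst J < snd J" using 3(1) C(1) X(2) by (auto simp: barcode_of_def)
        moreover have "snd J \<le> fst J + 2 * e" using 3(1) C(3) by blast
        ultimately show ?thesis by (auto simp: dist_bar_def mid_def field_simps)
      qed
    qed
    ultimately show "I \<in> half_line \<and> J \<in> half_line \<and> dist_bar I J \<le> e" by blast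
  next
    show "w0 (s, t) = int (count (image_mset fst Z) (s, t))" if "0 \<le> s" "s < t" for s t
      unfolding fst_Z using w0[OF that] mid_count[OF that(2)] by simp
    show "w1 (s, t) = int (count (image_mset snd Z) (s, t))" if "0 \<le> s" "s < t" for s t
      unfolding snd_Z using w1[OF that] mid_count[OF that(2)] by simp
  qed (fact \<open>0 \<le> e\<close>)
qed

section \<open>Ranks in an interleaving\<close>

text \<open>\<open>G i\<close> is a grid for the restriction of the interleaving to the \<open>i\<close>-th copy of the half line.\<close>

locale stepwise_interleaving = persistence K "interleaving_poset \<epsilon>" M
  for K :: "('k, 'r) ring_scheme" and \<epsilon> and M :: "(real \<times> nat, 'k, 'v) pmod" +
  fixes G :: "nat \<Rightarrow> real set"
  assumes finite_G: "finite (G i)"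
    and rank_G: "i \<in> {0, 1} \<Longrightarrow> 0 \<le> a \<Longrightarrow> a \<le> b \<Longrightarrow> G i \<inter> {a<..b} = {} \<Longrightarrow>
      pm_rank K M (a, i) (b, i) = pm_rank K M (a, i) (a, i) \<and>
      pm_rank K M (a, i) (b, i) = pm_rank K M (b, i) (b, i)"
begin

text \<open>With \<open>i = j\<close> and \<open>\<delta> = 0\<close> this is the rank function of one of the interleaved modules, and with
  \<open>i = 0\<close>, \<open>j = 1\<close>, \<open>\<delta> = \<epsilon>\<close> that of the image of the map between them.\<close>

definition shift_rank :: "nat \<Rightarrow> nat \<Rightarrow> real \<Rightarrow> real \<Rightarrow> real \<Rightarrow> int" where
  "shift_rank i j \<delta> a b = (if a < 0 then 0 else int (pm_rank K M (a, i) (b + \<delta>, j)))"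

lemma in_poset:
  assumes "i \<in> {0, 1}" "j \<in> {0, 1}" "0 \<le> a" "0 \<le> b" "a + \<epsilon> * \<bar>real i - real j\<bar> \<le> b"
  shows "((a, i), (b, j)) \<in> interleaving_poset \<epsilon>"
  using assms by (simp add: interleaving_poset_def)

lemma rank_function_shift_rank:
  assumes ij: "i \<in> {0, 1}" "j \<in> {0, 1}" and \<delta>: "0 \<le> \<delta>" "\<epsilon> * \<bar>real i - real j\<bar> \<le> \<delta>"
  shows "rank_function (shift_rank i j \<delta>) (insert 0 (G i \<union> (\<lambda>g. g - \<delta>) ` G j))"
proof
  show "finite (insert 0 (G i \<union> (\<lambda>g. g - \<delta>) ` G j))" using finite_G by simp
  show "0 \<in> insert 0 (G i \<union> (\<lambda>g. g - \<delta>) ` G j)" by simp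
  show "shift_rank i j \<delta> a b = 0" if "a < 0" for a b using that by (simp add: shift_rank_def)
  show "shift_rank i j \<delta> q s + shift_rank i j \<delta> p r \<le> shift_rank i j \<delta> q r + shift_rank i j \<delta> p s"
    if le: "p \<le> q" "q \<le> r" "r \<le> s" for p q r s
  proof -
    have qr: "((q, i), (r + \<delta>, j)) \<in> interleaving_poset \<epsilon>"
      and rs: "((r + \<delta>, j), (s + \<delta>, j)) \<in> interleaving_poset \<epsilon>" if "0 \<le> q"
      using that le ij \<delta> by (auto intro!: in_poset)
    consider "0 \<le> p" | "p < 0" "0 \<le> q" | "q < 0" using le by linarith
    then show ?thesis
    proof cases
      case 1
      then have "((p, i), (q, i)) \<in> interleaving_poset \<epsilon>" using le ij by (intro in_poset) auto
      from rank_frobenius[OF this qr rs] show ?thesis using 1 le by (simp add: shift_rank_def)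
    next
      case 2
      then show ?thesis using rank_mono_right[OF qr rs] by (simp add: shift_rank_def)
    next
      case 3
      then show ?thesis using le by (simp add: shift_rank_def)
    qed
  qed
  show "shift_rank i j \<delta> a b = shift_rank i j \<delta> a' b"
    if le: "0 \<le> a" "a \<le> a'" "a' \<le> b" and disj: "insert 0 (G i \<union> (\<lambda>g. g - \<delta>) ` G j) \<inter> {a<..a'} = {}"
    for a a' b
  proof -
    have "G i \<inter> {a<..a'} = {}" using disj by blast
    then show ?thesis
      using rank_step(1)[of "(a, i)" "(a', i)" "(b + \<delta>, j)"] rank_G[OF ij(1) le(1,2)]
        in_poset[OF ij(1,1), of a a'] in_poset[OF ij, of a' "b + \<delta>"] le \<delta>
      by (simp add: shift_rank_def)
  qed
  show "shift_rank i j \<delta> a b = shift_rank i j \<delta> a b'"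
    if le: "0 \<le> a" "a \<le> b" "b \<le> b'" and disj: "insert 0 (G i \<union> (\<lambda>g. g - \<delta>) ` G j) \<inter> {b<..b'} = {}"
    for a b b'
  proof -
    have "G j \<inter> {b + \<delta><..b' + \<delta>} = {}"
    proof -
      have "g \<notin> {b + \<delta><..b' + \<delta>}" if "g \<in> G j" for g
      proof -
        have "g - \<delta> \<notin> {b<..b'}" using disj that by blast
        then show ?thesis by auto
      qed
      then show ?thesis by blast
    qed
    then show ?thesis
      using rank_step(2)[of "(b + \<delta>, j)" "(b' + \<delta>, j)" "(a, i)"] rank_G[OF ij(2), of "b + \<delta>" "b' + \<delta>"]
        in_poset[OF ij(2,2), of "b + \<delta>" "b' + \<delta>"] in_poset[OF ij, of a "b + \<delta>"] le \<delta>
      by (simp add: shift_rank_def)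
  qed
qed

text \<open>The next four lemmas are Frobenius' inequality for the chains
  \<open>(p, 0) \<le> (q, 0) \<le> (r, 0) \<le> (r + \<epsilon>, 1)\<close> and
  \<open>(p, 0) \<le> (q, 0) \<le> (r + \<epsilon>, 1) \<le> (r + 2 \<epsilon>, 0)\<close> (births), and
  \<open>(x, 0) \<le> (x + \<epsilon>, 1) \<le> (d' + \<epsilon>, 1) \<le> (d + \<epsilon>, 1)\<close> and
  \<open>(x, 1) \<le> (x + \<epsilon>, 0) \<le> (d' + \<epsilon>, 1) \<le> (d + \<epsilon>, 1)\<close> (deaths). Where the first point of the chain has
  a negative coordinate, monotonicity of ranks takes its place.\<close>

lemma shift_rank_births_le:
  assumes "0 < \<epsilon>" "p \<le> q" "q \<le> r"
  shows "shift_rank 0 1 \<epsilon> q r - shift_rank 0 1 \<epsilon> p r \<le> shift_rank 0 0 0 q r - shift_rank 0 0 0 p r"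
proof -
  consider "0 \<le> p" | "p < 0" "0 \<le> q" | "q < 0" by linarith
  then show ?thesis
  proof cases
    case 1
    then show ?thesis
      using rank_frobenius[of "(p, 0)" "(q, 0)" "(r, 0)" "(r + \<epsilon>, 1)"] assms
      by (simp add: shift_rank_def in_poset)
  next
    case 2
    then show ?thesis
      using rank_mono_right[of "(q, 0)" "(r, 0)" "(r + \<epsilon>, 1)"] assms
      by (simp add: shift_rank_def in_poset)
  next
    case 3
    then show ?thesis using assms by (simp add: shift_rank_def)
  qed
qed

lemma shift_rank_births_ge:
  assumes "0 < \<epsilon>" "p \<le> q" "q \<le> r"
  shows "shift_rank 0 0 0 q (r + 2 * \<epsilon>) - shift_rank 0 0 0 p (r + 2 * \<epsilon>) \<le>
    shift_rank 0 1 \<epsilon> q r - shift_rank 0 1 \<epsilon> p r"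
proof -
  consider "0 \<le> p" | "p < 0" "0 \<le> q" | "q < 0" by linarith
  then show ?thesis
  proof cases
    case 1
    then show ?thesis
      using rank_frobenius[of "(p, 0)" "(q, 0)" "(r + \<epsilon>, 1)" "(r + 2 * \<epsilon>, 0)"] assms
      by (simp add: shift_rank_def in_poset)
  next
    case 2
    then show ?thesis
      using rank_mono_right[of "(q, 0)" "(r + \<epsilon>, 1)" "(r + 2 * \<epsilon>, 0)"] assms
      by (simp add: shift_rank_def in_poset)
  next
    case 3
    then show ?thesis using assms by (simp add: shift_rank_def)
  qed
qed

lemma shift_rank_deaths_le:
  assumes "0 < \<epsilon>" "x \<le> d'" "d' \<le> d"
  shows "shift_rank 0 1 \<epsilon> x d' - shift_rank 0 1 \<epsilon> x d \<le>
    shift_rank 1 1 0 (x + \<epsilon>) (d' + \<epsilon>) - shift_rank 1 1 0 (x + \<epsilon>) (d + \<epsilon>)"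
proof -
  consider "0 \<le> x" | "x < 0" "0 \<le> x + \<epsilon>" | "x + \<epsilon> < 0" by linarith
  then show ?thesis
  proof cases
    case 1
    then show ?thesis
      using rank_frobenius[of "(x, 0)" "(x + \<epsilon>, 1)" "(d' + \<epsilon>, 1)" "(d + \<epsilon>, 1)"] assms
      by (simp add: shift_rank_def in_poset)
  next
    case 2
    then show ?thesis
      using rank_mono_right[of "(x + \<epsilon>, 1)" "(d' + \<epsilon>, 1)" "(d + \<epsilon>, 1)"] assms
      by (simp add: shift_rank_def in_poset)
  next
    case 3
    then show ?thesis using assms by (simp add: shift_rank_def)
  qed
qed

lemma shift_rank_deaths_ge:
  assumes "0 < \<epsilon>" "x + \<epsilon> \<le> d'" "d' \<le> d"
  shows "shift_rank 1 1 0 x (d' + \<epsilon>) - shift_rank 1 1 0 x (d + \<epsilon>) \<le>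
    shift_rank 0 1 \<epsilon> (x + \<epsilon>) d' - shift_rank 0 1 \<epsilon> (x + \<epsilon>) d"
proof -
  consider "0 \<le> x" | "x < 0" "0 \<le> x + \<epsilon>" | "x + \<epsilon> < 0" by linarith
  then show ?thesis
  proof cases
    case 1
    then show ?thesis
      using rank_frobenius[of "(x, 1)" "(x + \<epsilon>, 0)" "(d' + \<epsilon>, 1)" "(d + \<epsilon>, 1)"] assms
      by (simp add: shift_rank_def in_poset)
  next
    case 2
    then show ?thesis
      using rank_mono_right[of "(x + \<epsilon>, 0)" "(d' + \<epsilon>, 1)" "(d + \<epsilon>, 1)"] assms
      by (simp add: shift_rank_def in_poset)
  next
    case 3
    then show ?thesis using assms by (simp add: shift_rank_def)
  qed
qed

end

section \<open>Stability\<close>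

lemma interleaving_rank:
  assumes \<Gamma>: "persistence_module K (interleaving_poset \<epsilon>) \<Gamma>" and "i \<in> {0, 1}"
    and iso: "pm_iso K half_line (pm_comp \<Gamma> (\<lambda>a. (a, i))) M" and ab: "0 \<le> a" "a \<le> b"
  shows "pm_rank K M a b = pm_rank K \<Gamma> (a, i) (b, i)"
proof -
  have F: "(c, i) \<in> Field (interleaving_poset \<epsilon>)" if "0 \<le> c" for c
    using that \<open>i \<in> {0, 1}\<close> by (simp add: Field_interleaving_poset)
  have I: "((c, i), (d, i)) \<in> interleaving_poset \<epsilon>" if "0 \<le> c" "c \<le> d" for c d
    using that \<open>i \<in> {0, 1}\<close> by (simp add: interleaving_poset_def)
  have "persistence_module K half_line (pm_comp \<Gamma> (\<lambda>a. (a, i)))"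
    unfolding persistence_module_def
  proof (intro conjI ballI allI impI)
    fix c assume c: "c \<in> Field half_line"
    then have "(c, i) \<in> Field (interleaving_poset \<epsilon>)" by (simp add: F Field_half_line)
    then show "vectorspace K (pm_space (pm_comp \<Gamma> (\<lambda>a. (a, i))) c)"
      "vectorspace.fin_dim K (pm_space (pm_comp \<Gamma> (\<lambda>a. (a, i))) c)"
      "\<And>x. x \<in> carrier (pm_space (pm_comp \<Gamma> (\<lambda>a. (a, i))) c) \<Longrightarrow>
        pm_map (pm_comp \<Gamma> (\<lambda>a. (a, i))) c c x = x"
      using \<Gamma> by (simp_all add: persistence_module_def pm_comp_def)
  next
    fix c d assume cd: "(c, d) \<in> half_line"
    then have CD: "((c, i), (d, i)) \<in> interleaving_poset \<epsilon>" using I by (simp add: half_line_def)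
    then show "linear_map K (pm_space (pm_comp \<Gamma> (\<lambda>a. (a, i))) c)
        (pm_space (pm_comp \<Gamma> (\<lambda>a. (a, i))) d) (pm_map (pm_comp \<Gamma> (\<lambda>a. (a, i))) c d)"
      using \<Gamma> unfolding persistence_module_def pm_comp_def by simp
    fix e x assume "(d, e) \<in> half_line" "x \<in> carrier (pm_space (pm_comp \<Gamma> (\<lambda>a. (a, i))) c)"
    moreover from this(1) have "((d, i), (e, i)) \<in> interleaving_poset \<epsilon>"
      using I by (simp add: half_line_def)
    ultimately show "pm_map (pm_comp \<Gamma> (\<lambda>a. (a, i))) d e (pm_map (pm_comp \<Gamma> (\<lambda>a. (a, i))) c d x) =
        pm_map (pm_comp \<Gamma> (\<lambda>a. (a, i))) c e x"
      using \<Gamma> CD unfolding persistence_module_def pm_comp_def pmod.simps by blast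
  qed
  then have "pm_rank K M a b = pm_rank K (pm_comp \<Gamma> (\<lambda>a. (a, i))) a b"
    using ab by (intro rank_pm_iso[OF _ _ iso]) (auto simp: half_line_def)
  then show ?thesis by (simp add: pm_rank_def pm_comp_def)
qed

lemma bottleneck_le_of_interleaving:
  fixes M0 M1 :: "(real, 'k, 'v) pmod"
  assumes M0: "persistence_module K half_line M0" "constructible K half_line M0"
    and M1: "persistence_module K half_line M1" "constructible K half_line M1"
    and "0 < \<epsilon>" and \<Gamma>: "is_interleaving K \<epsilon> M0 M1 \<Gamma>"
  shows "bottleneck_distance (persistence_diagram K half_line M0)
    (persistence_diagram K half_line M1) \<le> ereal \<epsilon>"
proof -
  define N where "N i = (if i = 0 then M0 else M1)" for i :: nat
  have N: "persistence_module K half_line (N i)" "constructible K half_line (N i)" for i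
    using M0 M1 by (simp_all add: N_def)
  have pm\<Gamma>: "persistence_module K (interleaving_poset \<epsilon>) \<Gamma>"
    using \<Gamma> by (simp add: is_interleaving_def)
  have rank_N: "pm_rank K (N i) a b = pm_rank K \<Gamma> (a, i) (b, i)"
    if "i \<in> {0, 1}" "0 \<le> a" "a \<le> b" for i a b
    using \<Gamma> that by (intro interleaving_rank[OF pm\<Gamma>]) (auto simp: is_interleaving_def N_def)
  have "\<exists>G. finite G \<and> (\<forall>a b. 0 \<le> a \<longrightarrow> a \<le> b \<longrightarrow> G \<inter> {a<..b} = {} \<longrightarrow>
      bij_betw (pm_map (N i) a b) (carrier (pm_space (N i) a)) (carrier (pm_space (N i) b)))" for i
    using constructible_steps[OF N(1,2)[of i]] by metis
  then obtain G where G: "\<And>i. finite (G i)"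
    "\<And>i a b. 0 \<le> a \<Longrightarrow> a \<le> b \<Longrightarrow> G i \<inter> {a<..b} = {} \<Longrightarrow>
      bij_betw (pm_map (N i) a b) (carrier (pm_space (N i) a)) (carrier (pm_space (N i) b))"
    by metis
  have pN: "persistence K half_line (N i)" for i
    using N(1) Partial_order_half_line by (simp add: persistence_def)
  interpret stepwise_interleaving K \<epsilon> \<Gamma> G
  proof
    show "Partial_order (interleaving_poset \<epsilon>)"
      by (rule Partial_order_interleaving_poset[OF \<open>0 < \<epsilon>\<close>])
    show "persistence_module K (interleaving_poset \<epsilon>) \<Gamma>" by (rule pm\<Gamma>)
    show "finite (G i)" for i by (rule G(1))
    show "pm_rank K \<Gamma> (a, i) (b, i) = pm_rank K \<Gamma> (a, i) (a, i) \<and>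
        pm_rank K \<Gamma> (a, i) (b, i) = pm_rank K \<Gamma> (b, i) (b, i)"
      if "i \<in> {0, 1}" "0 \<le> a" "a \<le> b" "G i \<inter> {a<..b} = {}" for i a b
      using persistence.rank_eq_if_bij[OF pN _ G(2)[OF that(2-4)]] rank_N[OF that(1)] that(2,3)
      by (simp add: half_line_def)
  qed
  have diag: "\<exists>B. barcode_of (shift_rank i i 0) B \<and>
      (\<forall>s t. 0 \<le> s \<longrightarrow> s < t \<longrightarrow> persistence_diagram K half_line (N i) (s, t) = int (count B (s, t)))"
    if i: "i \<in> {0, 1}" for i
  proof -
    interpret rank_function "shift_rank i i 0" "insert 0 (G i \<union> (\<lambda>g. g - 0) ` G i)"
      by (rule rank_function_shift_rank) (use i in auto)
    obtain m B where m: "is_moebius_inversion (bar_order half_line)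
        (\<lambda>(a, b). shift_rank i i 0 a a - shift_rank i i 0 a b) m"
      and B: "\<And>s t. 0 \<le> s \<Longrightarrow> s < t \<Longrightarrow> m (s, t) = int (count B (s, t))"
        "barcode_of (shift_rank i i 0) B"
      by (rule barcode) blast
    have "is_moebius_inversion (bar_order half_line) (nullity K (N i)) m"
    proof (rule is_moebius_inversion_cong[OF m])
      fix y assume "y \<in> Field (bar_order half_line)"
      then have "y \<in> half_line" by (simp add: Field_bar_order[OF Partial_order_half_line])
      then obtain a b where "y = (a, b)" "(a, b) \<in> half_line" "0 \<le> a" "a \<le> b"
        by (cases y) (auto simp: half_line_def)
      then show "(case y of (a, b) \<Rightarrow> shift_rank i i 0 a a - shift_rank i i 0 a b) = nullity K (N i) y"
        using persistence.nullity_eq_rank[OF pN] rank_N[OF i] by (simp add: shift_rank_def)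
    qed
    then have "persistence_diagram K half_line (N i) = m"
      by (rule persistence_diagram_eqI[OF Partial_order_half_line])
    then show ?thesis using B by blast
  qed
  obtain B0 where B0: "barcode_of (shift_rank 0 0 0) B0"
    "\<And>s t. 0 \<le> s \<Longrightarrow> s < t \<Longrightarrow> persistence_diagram K half_line M0 (s, t) = int (count B0 (s, t))"
    using diag[of 0] by (auto simp: N_def)
  obtain B1 where B1: "barcode_of (shift_rank 1 1 0) B1"
    "\<And>s t. 0 \<le> s \<Longrightarrow> s < t \<Longrightarrow> persistence_diagram K half_line M1 (s, t) = int (count B1 (s, t))"
    using diag[of 1] by (auto simp: N_def)
  interpret rank_function "shift_rank 0 1 \<epsilon>" "insert 0 (G 0 \<union> (\<lambda>g. g - \<epsilon>) ` G 1)"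
    by (rule rank_function_shift_rank) (use \<open>0 < \<epsilon>\<close> in auto)
  obtain B where B: "barcode_of (shift_rank 0 1 \<epsilon>) B"
    by (rule barcode)
  show ?thesis
    by (rule bottleneck_le_of_rank_functions[OF B0(1) B1(1) B])
      (use \<open>0 < \<epsilon>\<close> shift_rank_births_le shift_rank_births_ge shift_rank_deaths_le
        shift_rank_deaths_ge B0(2) B1(2) in simp_all)
qed

theorem theorem6p1:
  fixes K :: "('k, 'r) ring_scheme"
    and M0 M1 :: "(real, 'k, 'v) pmod"
    and m0 m1 :: "real \<times> real \<Rightarrow> int"
  assumes "field K"
    and "persistence_module K half_line M0" and "constructible K half_line M0"
    and "persistence_module K half_line M1" and "constructible K half_line M1"
    and "m0 = persistence_diagram K half_line M0"
    and "m1 = persistence_diagram K half_line M1"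
  shows "bottleneck_distance m0 m1 \<le> interleaving_distance K M0 M1"
  unfolding interleaving_distance_def
proof (rule Inf_greatest)
  fix x
  assume "x \<in> {ereal \<epsilon> | \<epsilon>. 0 < \<epsilon> \<and>
    (\<exists>\<Gamma> :: (real \<times> nat, 'k, 'v) pmod. is_interleaving K \<epsilon> M0 M1 \<Gamma>)}"
  then obtain \<epsilon> and \<Gamma> :: "(real \<times> nat, 'k, 'v) pmod"
    where "x = ereal \<epsilon>" "0 < \<epsilon>" "is_interleaving K \<epsilon> M0 M1 \<Gamma>" by blast
  then show "bottleneck_distance m0 m1 \<le> x"
    using bottleneck_le_of_interleaving[OF assms(2-5)] assms(6,7) by blast
qed

end
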